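(* Let $X$ be a two-sided quaternionic Banach space, let $T\in\mathcal{B}_R(X)$, let $i\in\mathbb{S}$ be fixed, and let $D$ be a bounded slice Cauchy domain with $\sigma_S(T)\subset D$; put $D_i=D\cap\mathbb{C}_i$. (a) Let $f$ be a right slice hyperholomorphic function with $\overline{D}\subset\mathcal{D}(f)$. Then there exist intrinsic slice hyperholomorphic functions $f_1,f_2,f_3,f_4$ on $\mathcal{D}(f)$ with $f=f_1+\mathrm{i}f_2+\mathrm{j}f_3+\mathrm{k}f_4$, and $$f(T)=\frac{1}{2\pi i}\int_{\partial D_i}\Delta_s^{-1}f_1(s)ds+\mathrm{i}\,\frac{1}{2\pi i}\int_{\partial D_i}\Delta_s^{-1}f_2(s)ds+\mathrm{j}\,\frac{1}{2\pi i}\int_{\partial D_i}\Delta_s^{-1}f_3(s)ds+\mathrm{k}\,\frac{1}{2\pi i}\int_{\partial D_i}\Delta_s^{-1}f_4(s)ds.$$ (b) Let $f$ be a left slice hyperholomorphic function with $\overline{D}\subset\mathcal{D}(f)$. Then there exist intrinsic slice hyperholomorphic functions $f_1,f_2,f_3,f_4$ on $\mathcal{D}(f)$ with $f=f_1+f_2\mathrm{i}+f_3\mathrm{j}+f_4\mathrm{k}$, and $$f(T)=\frac{1}{2\pi i}\int_{\partial D_i}\Delta_s^{-1}f_1(s)ds+\Big(\frac{1}{2\pi i}\int_{\partial D_i}\Delta_s^{-1}f_2(s)ds\Big)\mathrm{i}+\Big(\frac{1}{2\pi i}\int_{\partial D_i}\Delta_s^{-1}f_3(s)ds\Big)\mathrm{j}+\Big(\frac{1}{2\pi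 i}\int_{\partial D_i}\Delta_s^{-1}f_4(s)ds\Big)\mathrm{k}.$$ Here $f(T)$ is defined by the S-functional calculus.
   Context: $\mathbb{H}$ denotes the quaternions with standard units $\mathrm{i},\mathrm{j},\mathrm{k}$ (the italic $i$ is an arbitrary fixed element of $\mathbb{S}$). $\mathbb{S}=\{q\in\mathbb{H}:q^2=-1\}$, $\mathbb{C}_j=\{\alpha+\beta j:\alpha,\beta\in\mathbb{R}\}$ for $j\in\mathbb{S}$, and $[q]=\{\mathrm{Re}(q)+|\mathrm{Im}(q)|j: j\in\mathbb{S}\}$. A set $U\subseteq\mathbb{H}$ is axially symmetric if $[q]\subset U$ for all $q\in U$. A two-sided quaternionic Banach space $X$ is an abelian group which is both a left and a right $\mathbb{H}$-vector space, with $rx=xr$ for $r\in\mathbb{R}$ and $(px)q=p(xq)$ for $p,q\in\mathbb{H}$, complete for a norm with $\|qx\|=\|xq\|=|q|\,\|x\|$. $\mathcal{B}_R(X)$ is the set of bounded right $\mathbb{H}$-linear operators on $X$; it carries left and right quaternionic multiplications $(qT)x=q(Tx)$ and $(Tq)x=T(qx)$. $Q_q(T)=T^2-2\mathrm{Re}(q)T+|q|^2I$; $\rho_S(T)=\{q\in\mathbb{H}:Q_q(T)\text{ is invertible in }\mathcal{B}_R(X)\}$ and $\sigma_S(T)=\mathbb{H}\setminus\rho_S(T)$. For $s\in\rho_S(T)$, $S_L^{-1}(s,T)=-Q_s(T)^{-1}(T-\bar sI)$ and $S_R^{-1}(s,T)=-(T-\bar sI)Q_s(T)^{-1}$. S-functional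 calculus: with $ds_i=ds/i=-i\,ds$, for $f$ right slice hyperholomorphic $f(T)=\frac{1}{2\pi}\int_{\partial D_i}f(s)\,ds_i\,S_R^{-1}(s,T)$, and for $f$ left slice hyperholomorphic $f(T)=\frac{1}{2\pi}\int_{\partial D_i}S_L^{-1}(s,T)\,ds_i\,f(s)$. Identify $\mathbb{C}_i$ with $\mathbb{C}$; $X_i$ is $X$ viewed as a complex Banach space via right multiplication by $\mathbb{C}_i$, and $T_i$ is $T$ viewed as a complex linear operator on $X_i$. $\Delta_s=R_s-T$, where $R_sx=xs$; for $s\in\rho_S(T)\cap\mathbb{C}_i$, $\Delta_s^{-1}=(sI-T_i)^{-1}$. The integrals $\frac{1}{2\pi i}\int_{\partial D_i}\Delta_s^{-1}f_m(s)ds$ are Riesz–Dunford integrals in $\mathcal{B}(X_i)$, the bounded complex linear operators on $X_i$, scalars in $\mathbb{C}_i$ acting by the complex structure of $X_i$ (right multiplication on vectors); for intrinsic $f_m$ the resulting operators belong to $\mathcal{B}_R(X)$, so that they may be multiplied by $\mathrm{i},\mathrm{j},\mathrm{k}$ on the left or right using the quaternionic multiplications $(qA)x=q(Ax)$ and $(Aq)x=A(qx)$ for $A\in\mathcal{B}_R(X)$, $q\in\mathbb{H}$, $x\in X$. Slice hyperholomorphic functions: let $U\subseteq\mathbb{H}$ be an axially symmetric open set and $\mathcal{U}=\{(\alpha,\beta)\in\mathbb{R}^2:\alpha+\beta\mathbb{S}\subset U\}$. $f:U\to\mathbb{H}$ is left slice hyperholomorphic if there are (continuously differentiable) $g_0,g_1:\mathcal{U}\to\mathbb{H}$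 with $f(\alpha+\beta j)=g_0(\alpha,\beta)+jg_1(\alpha,\beta)$ for all $\alpha+\beta j\in U$ ($j\in\mathbb{S}$), with $g_0(\alpha,-\beta)=g_0(\alpha,\beta)$, $g_1(\alpha,-\beta)=-g_1(\alpha,\beta)$, and $\partial_\alpha g_0-\partial_\beta g_1=0$, $\partial_\beta g_0+\partial_\alpha g_1=0$. It is right slice hyperholomorphic if the same holds with $f(\alpha+\beta j)=g_0(\alpha,\beta)+g_1(\alpha,\beta)j$. It is intrinsic if moreover $g_0,g_1$ are real-valued. $\mathcal{D}(f)$ is the domain of $f$. A slice Cauchy domain is an axially symmetric open set $D\subset\mathbb{H}$ such that for every $j\in\mathbb{S}$, $\partial(D\cap\mathbb{C}_j)$ is the union of finitely many nonintersecting piecewise continuously differentiable Jordan curves in $\mathbb{C}_j$; $\partial D_i$ is positively oriented. *)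

theory Defs
  imports "HOL-Complex_Analysis.Complex_Analysis"
begin

section \<open>Quaternions\<close>

datatype quat = Quat (qRe: real) (qIm1: real) (qIm2: real) (qIm3: real)

lemma quat_eq_iff:
  "p = q \<longleftrightarrow> qRe p = qRe q \<and> qIm1 p = qIm1 q \<and> qIm2 p = qIm2 q \<and> qIm3 p = qIm3 q"
  by (cases p; cases q) auto

instantiation quat :: real_vector
begin

definition "0 = Quat 0 0 0 0"
definition "p + q = Quat (qRe p + qRe q) (qIm1 p + qIm1 q) (qIm2 p + qIm2 q) (qIm3 p + qIm3 q)"
definition "- q = Quat (- qRe q) (- qIm1 q) (- qIm2 q) (- qIm3 q)"
definition "p - q = Quat (qRe p - qRe q) (qIm1 p - qIm1 q) (qIm2 p - qIm2 q) (qIm3 p - qIm3 q)"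
definition "scaleR r q = Quat (r * qRe q) (r * qIm1 q) (r * qIm2 q) (r * qIm3 q)"

instance
  by standard
    (auto simp: quat_eq_iff zero_quat_def plus_quat_def uminus_quat_def minus_quat_def
      scaleR_quat_def algebra_simps)

end

lemma quat_sel_vector [simp]:
  "qRe 0 = 0" "qIm1 0 = 0" "qIm2 0 = 0" "qIm3 0 = 0"
  "qRe (p + q) = qRe p + qRe q" "qIm1 (p + q) = qIm1 p + qIm1 q"
  "qIm2 (p + q) = qIm2 p + qIm2 q" "qIm3 (p + q) = qIm3 p + qIm3 q"
  "qRe (- q) = - qRe q" "qIm1 (- q) = - qIm1 q" "qIm2 (- q) = - qIm2 q" "qIm3 (- q) = - qIm3 q"
  "qRe (p - q) = qRe p - qRe q" "qIm1 (p - q) = qIm1 p - qIm1 q"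
  "qIm2 (p - q) = qIm2 p - qIm2 q" "qIm3 (p - q) = qIm3 p - qIm3 q"
  "qRe (r *\<^sub>R q) = r * qRe q" "qIm1 (r *\<^sub>R q) = r * qIm1 q"
  "qIm2 (r *\<^sub>R q) = r * qIm2 q" "qIm3 (r *\<^sub>R q) = r * qIm3 q"
  by (simp_all add: zero_quat_def plus_quat_def uminus_quat_def minus_quat_def scaleR_quat_def)

instantiation quat :: euclidean_space
begin

definition "inner p q = qRe p * qRe q + qIm1 p * qIm1 q + qIm2 p * qIm2 q + qIm3 p * qIm3 q"
definition norm_quat_def:
  "norm q = sqrt ((qRe q)\<^sup>2 + (qIm1 q)\<^sup>2 + (qIm2 q)\<^sup>2 + (qIm3 q)\<^sup>2)"
definition "sgn (q::quat) = q /\<^sub>R norm q"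
definition "dist (p::quat) q = norm (p - q)"
definition uniformity_quat_def [code del]:
  "(uniformity :: (quat \<times> quat) filter) = (INF e\<in>{0 <..}. principal {(x, y). dist x y < e})"
definition open_quat_def [code del]:
  "open (U :: quat set) \<longleftrightarrow> (\<forall>x\<in>U. eventually (\<lambda>(x', y). x' = x \<longrightarrow> y \<in> U) uniformity)"
definition "Basis = {Quat 1 0 0 0, Quat 0 1 0 0, Quat 0 0 1 0, Quat 0 0 0 1}"

instance
proof
  fix x y z :: quat and r :: real and S :: "quat set"
  show "sgn x = x /\<^sub>R norm x" by (rule sgn_quat_def)
  show "dist x y = norm (x - y)" by (rule dist_quat_def)
  show "(uniformity :: (quat \<times> quat) filter) = (INF e\<in>{0 <..}. principal {(x, y). dist x y < e})"
    by (rule uniformity_quat_def)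
  show "open S \<longleftrightarrow> (\<forall>x\<in>S. eventually (\<lambda>(x', y). x' = x \<longrightarrow> y \<in> S) uniformity)"
    by (rule open_quat_def)
  show "inner x y = inner y x" by (simp add: inner_quat_def mult.commute)
  show "inner (x + y) z = inner x z + inner y z" by (simp add: inner_quat_def algebra_simps)
  show "inner (r *\<^sub>R x) y = r * inner x y" by (simp add: inner_quat_def algebra_simps)
  show "0 \<le> inner x x" by (simp add: inner_quat_def)
  show "inner x x = 0 \<longleftrightarrow> x = 0"
    by (simp add: inner_quat_def quat_eq_iff add_nonneg_eq_0_iff)
  show "norm x = sqrt (inner x x)"
    by (simp add: inner_quat_def norm_quat_def power2_eq_square)
  show "(\<forall>u\<in>Basis. inner x u = 0) \<longleftrightarrow> x = 0"
    unfolding Basis_quat_def by (simp add: inner_quat_def) (simp add: quat_eq_iff[of x])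
qed (auto simp: Basis_quat_def inner_quat_def)

end

instantiation quat :: real_normed_div_algebra
begin

definition "1 = Quat 1 0 0 0"
definition "p * q = Quat
  (qRe p * qRe q - qIm1 p * qIm1 q - qIm2 p * qIm2 q - qIm3 p * qIm3 q)
  (qRe p * qIm1 q + qIm1 p * qRe q + qIm2 p * qIm3 q - qIm3 p * qIm2 q)
  (qRe p * qIm2 q - qIm1 p * qIm3 q + qIm2 p * qRe q + qIm3 p * qIm1 q)
  (qRe p * qIm3 q + qIm1 p * qIm2 q - qIm2 p * qIm1 q + qIm3 p * qRe q)"
definition inverse_quat_def:
  "inverse q = Quat (qRe q) (- qIm1 q) (- qIm2 q) (- qIm3 q) /\<^sub>R (norm q)\<^sup>2"
definition "(p::quat) div q = p * inverse q"

instance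
proof
  fix x y z :: quat and r :: real
  have sq: "(norm q)\<^sup>2 = (qRe q)\<^sup>2 + (qIm1 q)\<^sup>2 + (qIm2 q)\<^sup>2 + (qIm3 q)\<^sup>2" for q :: quat
    by (simp add: norm_quat_def)
  show "x * y * z = x * (y * z)" "(x + y) * z = x * z + y * z" "x * (y + z) = x * y + x * z"
    "(r *\<^sub>R x) * y = r *\<^sub>R (x * y)" "x * (r *\<^sub>R y) = r *\<^sub>R (x * y)"
    by (simp_all add: times_quat_def quat_eq_iff algebra_simps)
  show "1 * x = x" "x * 1 = x" "(0::quat) \<noteq> 1"
    by (simp_all add: times_quat_def one_quat_def quat_eq_iff)
  show "inverse x * x = 1" "x * inverse x = 1" if "x \<noteq> 0"
  proof -
    define c where "c = Quat (qRe x) (- qIm1 x) (- qIm2 x) (- qIm3 x)"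
    have inv: "inverse x = c /\<^sub>R (norm x)\<^sup>2" by (simp add: inverse_quat_def c_def)
    have "c * x = (norm x)\<^sup>2 *\<^sub>R 1" "x * c = (norm x)\<^sup>2 *\<^sub>R 1"
      unfolding sq
      by (simp_all add: c_def times_quat_def one_quat_def quat_eq_iff power2_eq_square)
    moreover have "(c /\<^sub>R r) * x = (c * x) /\<^sub>R r" "x * (c /\<^sub>R r) = (x * c) /\<^sub>R r" for r
      by (simp_all add: times_quat_def quat_eq_iff algebra_simps)
    moreover have "(norm x)\<^sup>2 \<noteq> 0" using that by simp
    ultimately show "inverse x * x = 1" "x * inverse x = 1" unfolding inv by simp_all
  qed
  show "x div y = x * inverse y" by (rule divide_quat_def)
  show "inverse (0::quat) = 0" by (simp add: inverse_quat_def quat_eq_iff)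
  have "(norm (x * y))\<^sup>2 = (norm x * norm y)\<^sup>2"
    unfolding power_mult_distrib sq
    by (simp add: times_quat_def power2_eq_square algebra_simps)
  then show "norm (x * y) = norm x * norm y"
    by (simp add: power2_eq_iff_nonneg)
qed

end

definition qi :: quat where "qi = Quat 0 1 0 0"
definition qj :: quat where "qj = Quat 0 0 1 0"
definition qk :: quat where "qk = Quat 0 0 0 1"

definition qcnj :: "quat \<Rightarrow> quat" where
  "qcnj q = Quat (qRe q) (- qIm1 q) (- qIm2 q) (- qIm3 q)"

definition qIm :: "quat \<Rightarrow> quat" where
  "qIm q = Quat 0 (qIm1 q) (qIm2 q) (qIm3 q)"

definition imag_sphere :: "quat set" where
  "imag_sphere = {q. q\<^sup>2 = -1}"

definition sphere_class :: "quat \<Rightarrow> quat set" where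
  "sphere_class q = {of_real (qRe q) + of_real (norm (qIm q)) * j |j. j \<in> imag_sphere}"

definition axially_symmetric :: "quat set \<Rightarrow> bool" where
  "axially_symmetric U \<longleftrightarrow> (\<forall>q\<in>U. sphere_class q \<subseteq> U)"

text \<open>For \<open>j\<close> in \<open>imag_sphere\<close> this is the isometric isomorphism of \<open>\<complex>\<close> onto \<open>\<complex>\<^sub>j\<close>; subsets
  of \<open>\<complex>\<^sub>j\<close> and curves in \<open>\<complex>\<^sub>j\<close> are represented by their preimages in \<open>\<complex>\<close>.\<close>

definition slice_emb :: "quat \<Rightarrow> complex \<Rightarrow> quat" where
  "slice_emb j z = of_real (Re z) + of_real (Im z) * j"

definition slice_part :: "quat set \<Rightarrow> quat \<Rightarrow> complex set" where
  "slice_part D j = {z. slice_emb j z \<in> D}"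


section \<open>Slice hyperholomorphic functions\<close>

definition C1_on :: "(real \<times> real) set \<Rightarrow> (real \<times> real \<Rightarrow> quat) \<Rightarrow> bool" where
  "C1_on W g \<longleftrightarrow> (\<exists>g' :: real \<times> real \<Rightarrow> (real \<times> real) \<Rightarrow>\<^sub>L quat.
     (\<forall>p\<in>W. (g has_derivative blinfun_apply (g' p)) (at p)) \<and> continuous_on W g')"

definition partial_alpha :: "(real \<times> real \<Rightarrow> quat) \<Rightarrow> real \<Rightarrow> real \<Rightarrow> quat" where
  "partial_alpha g \<alpha> \<beta> = vector_derivative (\<lambda>t. g (t, \<beta>)) (at \<alpha>)"

definition partial_beta :: "(real \<times> real \<Rightarrow> quat) \<Rightarrow> real \<Rightarrow> real \<Rightarrow> quat" where
  "partial_beta g \<alpha> \<beta> = vector_derivative (\<lambda>t. g (\<alpha>, t)) (at \<beta>)"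

definition slice_plane :: "quat set \<Rightarrow> (real \<times> real) set" where
  "slice_plane U = {(\<alpha>, \<beta>). \<forall>j\<in>imag_sphere. of_real \<alpha> + of_real \<beta> * j \<in> U}"

definition slice_components ::
  "quat set \<Rightarrow> (real \<times> real \<Rightarrow> quat) \<Rightarrow> (real \<times> real \<Rightarrow> quat) \<Rightarrow> bool" where
  "slice_components U g0 g1 \<longleftrightarrow>
     C1_on (slice_plane U) g0 \<and> C1_on (slice_plane U) g1 \<and>
     (\<forall>\<alpha> \<beta>. (\<alpha>, \<beta>) \<in> slice_plane U \<longrightarrow>
        g0 (\<alpha>, -\<beta>) = g0 (\<alpha>, \<beta>) \<and> g1 (\<alpha>, -\<beta>) = - g1 (\<alpha>, \<beta>) \<and>
        partial_alpha g0 \<alpha> \<beta> - partial_beta g1 \<alpha> \<beta> = 0 \<and>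
        partial_beta g0 \<alpha> \<beta> + partial_alpha g1 \<alpha> \<beta> = 0)"

definition left_represents ::
  "quat set \<Rightarrow> (quat \<Rightarrow> quat) \<Rightarrow> (real \<times> real \<Rightarrow> quat) \<Rightarrow> (real \<times> real \<Rightarrow> quat) \<Rightarrow> bool" where
  "left_represents U f g0 g1 \<longleftrightarrow> (\<forall>\<alpha> \<beta>. \<forall>j\<in>imag_sphere. of_real \<alpha> + of_real \<beta> * j \<in> U \<longrightarrow>
     f (of_real \<alpha> + of_real \<beta> * j) = g0 (\<alpha>, \<beta>) + j * g1 (\<alpha>, \<beta>))"

definition right_represents ::
  "quat set \<Rightarrow> (quat \<Rightarrow> quat) \<Rightarrow> (real \<times> real \<Rightarrow> quat) \<Rightarrow> (real \<times> real \<Rightarrow> quat) \<Rightarrow> bool" where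
  "right_represents U f g0 g1 \<longleftrightarrow> (\<forall>\<alpha> \<beta>. \<forall>j\<in>imag_sphere. of_real \<alpha> + of_real \<beta> * j \<in> U \<longrightarrow>
     f (of_real \<alpha> + of_real \<beta> * j) = g0 (\<alpha>, \<beta>) + g1 (\<alpha>, \<beta>) * j)"

text \<open>In the next three definitions \<open>U\<close> is the domain of \<open>f\<close>; values of \<open>f\<close> outside \<open>U\<close> are
  irrelevant.\<close>

definition left_slice_hyperholomorphic :: "quat set \<Rightarrow> (quat \<Rightarrow> quat) \<Rightarrow> bool" where
  "left_slice_hyperholomorphic U f \<longleftrightarrow> open U \<and> axially_symmetric U \<and>
     (\<exists>g0 g1. slice_components U g0 g1 \<and> left_represents U f g0 g1)"

definition right_slice_hyperholomorphic :: "quat set \<Rightarrow> (quat \<Rightarrow> quat) \<Rightarrow> bool" where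
  "right_slice_hyperholomorphic U f \<longleftrightarrow> open U \<and> axially_symmetric U \<and>
     (\<exists>g0 g1. slice_components U g0 g1 \<and> right_represents U f g0 g1)"

text \<open>For real-valued \<open>g0\<close>, \<open>g1\<close> the left and the right representation coincide.\<close>

definition intrinsic_slice_hyperholomorphic :: "quat set \<Rightarrow> (quat \<Rightarrow> quat) \<Rightarrow> bool" where
  "intrinsic_slice_hyperholomorphic U f \<longleftrightarrow> open U \<and> axially_symmetric U \<and>
     (\<exists>g0 g1. slice_components U g0 g1 \<and> left_represents U f g0 g1 \<and>
        (\<forall>p\<in>slice_plane U. g0 p \<in> \<real> \<and> g1 p \<in> \<real>))"


section \<open>Slice Cauchy domains and integration over their boundaries\<close>

definition jordan_curve :: "(real \<Rightarrow> complex) \<Rightarrow> bool" where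
  "jordan_curve \<gamma> \<longleftrightarrow> valid_path \<gamma> \<and> simple_path \<gamma> \<and> pathfinish \<gamma> = pathstart \<gamma>"

definition bounded_by_jordan_curves :: "complex set \<Rightarrow> (real \<Rightarrow> complex) set \<Rightarrow> bool" where
  "bounded_by_jordan_curves W \<Gamma> \<longleftrightarrow> finite \<Gamma> \<and> (\<forall>\<gamma>\<in>\<Gamma>. jordan_curve \<gamma>) \<and>
     pairwise (\<lambda>\<gamma> \<delta>. path_image \<gamma> \<inter> path_image \<delta> = {}) \<Gamma> \<and>
     frontier W = (\<Union>\<gamma>\<in>\<Gamma>. path_image \<gamma>)"

definition slice_cauchy_domain :: "quat set \<Rightarrow> bool" where
  "slice_cauchy_domain D \<longleftrightarrow> open D \<and> axially_symmetric D \<and>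
     (\<forall>j\<in>imag_sphere. \<exists>\<Gamma>. bounded_by_jordan_curves (slice_part D j) \<Gamma>)"

text \<open>Positive orientation of the boundary of a bounded open set, as a cycle: the total winding
  number is 1 about the points of the set and 0 about the points outside its closure.\<close>

definition positively_oriented_boundary :: "complex set \<Rightarrow> (real \<Rightarrow> complex) set \<Rightarrow> bool" where
  "positively_oriented_boundary W \<Gamma> \<longleftrightarrow> bounded_by_jordan_curves W \<Gamma> \<and>
     (\<forall>z\<in>W. (\<Sum>\<gamma>\<in>\<Gamma>. winding_number \<gamma> z) = 1) \<and>
     (\<forall>z. z \<notin> closure W \<longrightarrow> (\<Sum>\<gamma>\<in>\<Gamma>. winding_number \<gamma> z) = 0)"

text \<open>In \<open>cycle_integral \<Gamma> h\<close> the two arguments of \<open>h\<close> stand for \<open>s\<close> and \<open>ds\<close>, so that integrands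
  with \<open>ds\<close> placed between noncommuting factors can be written.\<close>

definition cycle_integral ::
  "(real \<Rightarrow> complex) set \<Rightarrow> (complex \<Rightarrow> complex \<Rightarrow> 'b::real_normed_vector) \<Rightarrow> 'b" where
  "cycle_integral \<Gamma> h =
     (\<Sum>\<gamma>\<in>\<Gamma>. integral {0..1} (\<lambda>t. h (\<gamma> t) (vector_derivative \<gamma> (at t within {0..1}))))"


section \<open>Two-sided quaternionic Banach spaces\<close>

class quat_banach = banach +
  fixes lscale :: "quat \<Rightarrow> 'a \<Rightarrow> 'a"
    and rscale :: "'a \<Rightarrow> quat \<Rightarrow> 'a"
  assumes lscale_add_vec: "lscale q (x + y) = lscale q x + lscale q y"
    and lscale_add_scalar: "lscale (p + q) x = lscale p x + lscale q x"
    and lscale_lscale: "lscale p (lscale q x) = lscale (p * q) x"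
    and rscale_add_vec: "rscale (x + y) q = rscale x q + rscale y q"
    and rscale_add_scalar: "rscale x (p + q) = rscale x p + rscale x q"
    and rscale_rscale: "rscale (rscale x p) q = rscale x (p * q)"
    and lscale_of_real: "lscale (of_real r) x = r *\<^sub>R x"
    and rscale_of_real: "rscale x (of_real r) = r *\<^sub>R x"
    and lscale_rscale: "rscale (lscale p x) q = lscale p (rscale x q)"
    and norm_lscale: "norm (lscale q x) = norm q * norm x"
    and norm_rscale: "norm (rscale x q) = norm q * norm x"

instantiation quat :: quat_banach
begin

definition "lscale (q::quat) (x::quat) = q * x"
definition "rscale (x::quat) q = x * q"

instance
  by standard
    (simp_all add: lscale_quat_def rscale_quat_def algebra_simps norm_mult
      scaleR_conv_of_real[symmetric] of_real_def)

end

text \<open>Operators are elements of the real Banach space of bounded real linear maps, which contains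
  both the bounded right linear operators and, for each \<open>i\<close>, the bounded complex linear operators
  on \<open>X\<^sub>i\<close> as closed subspaces, with the same norm.\<close>

definition right_linear :: "('a::quat_banach \<Rightarrow>\<^sub>L 'a) \<Rightarrow> bool" where
  "right_linear A \<longleftrightarrow> (\<forall>x q. blinfun_apply A (rscale x q) = rscale (blinfun_apply A x) q)"

text \<open>The products \<open>qA\<close> and \<open>Aq\<close> of the bimodule of right linear operators are
  \<open>lmul_op q o\<^sub>L A\<close> and \<open>A o\<^sub>L lmul_op q\<close>, and \<open>lmul_op q\<close> itself is \<open>qI\<close>.\<close>

lift_definition lmul_op :: "quat \<Rightarrow> 'a::quat_banach \<Rightarrow>\<^sub>L 'a" is lscale
proof
  fix q r and x y :: 'a
  show "lscale q (x + y) = lscale q x + lscale q y" by (rule lscale_add_vec)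
  show "lscale q (r *\<^sub>R x) = r *\<^sub>R lscale q x"
    by (simp flip: lscale_of_real) (simp add: lscale_lscale scaleR_conv_of_real[symmetric] of_real_def)
  show "\<exists>K. \<forall>x::'a. norm (lscale q x) \<le> norm x * K"
    by (rule exI[of _ "norm q"]) (simp add: norm_lscale mult.commute)
qed

lift_definition rmul_op :: "quat \<Rightarrow> 'a::quat_banach \<Rightarrow>\<^sub>L 'a" is "\<lambda>q x. rscale x q"
proof
  fix q r and x y :: 'a
  show "rscale (x + y) q = rscale x q + rscale y q" by (rule rscale_add_vec)
  show "rscale (r *\<^sub>R x) q = r *\<^sub>R rscale x q"
    by (simp flip: rscale_of_real) (simp add: rscale_rscale scaleR_conv_of_real[symmetric] of_real_def)
  show "\<exists>K. \<forall>x::'a. norm (rscale x q) \<le> norm x * K"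
    by (rule exI[of _ "norm q"]) (simp add: norm_rscale mult.commute)
qed

text \<open>The inverse of a right linear or complex linear operator is again right linear or complex
  linear.\<close>

definition op_inv :: "('a::real_normed_vector \<Rightarrow>\<^sub>L 'a) \<Rightarrow> ('a \<Rightarrow>\<^sub>L 'a)" where
  "op_inv A = (THE B. A o\<^sub>L B = id_blinfun \<and> B o\<^sub>L A = id_blinfun)"

definition Q_op :: "quat \<Rightarrow> ('a::quat_banach \<Rightarrow>\<^sub>L 'a) \<Rightarrow> ('a \<Rightarrow>\<^sub>L 'a)" where
  "Q_op q T = (T o\<^sub>L T) - (2 * qRe q) *\<^sub>R T + (norm q)\<^sup>2 *\<^sub>R id_blinfun"

definition S_resolvent_set :: "('a::quat_banach \<Rightarrow>\<^sub>L 'a) \<Rightarrow> quat set" where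
  "S_resolvent_set T =
     {q. \<exists>B. right_linear B \<and> Q_op q T o\<^sub>L B = id_blinfun \<and> B o\<^sub>L Q_op q T = id_blinfun}"

definition S_spectrum :: "('a::quat_banach \<Rightarrow>\<^sub>L 'a) \<Rightarrow> quat set" where
  "S_spectrum T = - S_resolvent_set T"

definition S_L_inv :: "quat \<Rightarrow> ('a::quat_banach \<Rightarrow>\<^sub>L 'a) \<Rightarrow> ('a \<Rightarrow>\<^sub>L 'a)" where
  "S_L_inv s T = - (op_inv (Q_op s T) o\<^sub>L (T - lmul_op (qcnj s)))"

definition S_R_inv :: "quat \<Rightarrow> ('a::quat_banach \<Rightarrow>\<^sub>L 'a) \<Rightarrow> ('a \<Rightarrow>\<^sub>L 'a)" where
  "S_R_inv s T = - ((T - lmul_op (qcnj s)) o\<^sub>L op_inv (Q_op s T))"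

text \<open>S-functional calculus, integrating over a parametrization \<open>\<Gamma>\<close> of \<open>\<partial>D\<^sub>i\<close>, with
  \<open>ds\<^sub>i = - i ds\<close>.\<close>

definition S_calculus_right ::
  "quat \<Rightarrow> (real \<Rightarrow> complex) set \<Rightarrow> (quat \<Rightarrow> quat) \<Rightarrow> ('a::quat_banach \<Rightarrow>\<^sub>L 'a) \<Rightarrow> ('a \<Rightarrow>\<^sub>L 'a)" where
  "S_calculus_right i \<Gamma> f T = (1 / (2 * pi)) *\<^sub>R cycle_integral \<Gamma>
     (\<lambda>z dz. lmul_op (f (slice_emb i z) * (- i * slice_emb i dz)) o\<^sub>L S_R_inv (slice_emb i z) T)"

definition S_calculus_left ::
  "quat \<Rightarrow> (real \<Rightarrow> complex) set \<Rightarrow> (quat \<Rightarrow> quat) \<Rightarrow> ('a::quat_banach \<Rightarrow>\<^sub>L 'a) \<Rightarrow> ('a \<Rightarrow>\<^sub>L 'a)" where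
  "S_calculus_left i \<Gamma> f T = (1 / (2 * pi)) *\<^sub>R cycle_integral \<Gamma>
     (\<lambda>z dz. S_L_inv (slice_emb i z) T o\<^sub>L lmul_op ((- i * slice_emb i dz) * f (slice_emb i z)))"

definition Delta :: "quat \<Rightarrow> ('a::quat_banach \<Rightarrow>\<^sub>L 'a) \<Rightarrow> ('a \<Rightarrow>\<^sub>L 'a)" where
  "Delta s T = rmul_op s - T"

text \<open>The Riesz--Dunford integral of \<open>\<Delta>\<^sub>s\<inverse> f(s) ds\<close>, divided by \<open>2 \<pi> i\<close>, on \<open>X\<^sub>i\<close>, where a scalar
  \<open>c \<in> \<complex>\<^sub>i\<close> multiplies an operator by composition with \<open>rmul_op c\<close>.\<close>

definition riesz_dunford ::
  "quat \<Rightarrow> (real \<Rightarrow> complex) set \<Rightarrow> (quat \<Rightarrow> quat) \<Rightarrow> ('a::quat_banach \<Rightarrow>\<^sub>L 'a) \<Rightarrow> ('a \<Rightarrow>\<^sub>L 'a)" where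
  "riesz_dunford i \<Gamma> f T = rmul_op (inverse (of_real (2 * pi) * i)) o\<^sub>L cycle_integral \<Gamma>
     (\<lambda>z dz. rmul_op (f (slice_emb i z) * slice_emb i dz) o\<^sub>L op_inv (Delta (slice_emb i z) T))"

end

theory Submission
  imports Defs
begin

text \<open>Write \<open>s \<in> \<complex>\<^sub>i\<close>, \<open>A = Q\<^sub>s(T)\<inverse>\<close> and \<open>B = T A\<close>; both depend on \<open>s\<close> only through \<open>Re s\<close> and \<open>|s|\<close>.
  Since \<open>Q\<^sub>s(T)\<close> is the product of \<open>\<Delta>\<^sub>s\<close> and the operator of the conjugate point, \<open>\<Delta>\<^sub>s\<inverse>\<close> is \<open>A\<close> multiplied
  by \<open>cnj s\<close> minus \<open>B\<close>, and both S-resolvents have the same shape; only the side of the scalar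
  multiplication differs. For intrinsic \<open>f\<close> all three integrals therefore share the integral of a real
  part \<open>P\<close> and differ only in how \<open>i\<close> multiplies the integral of an imaginary part \<open>N\<close>. Adding to the
  Riesz--Dunford integral over \<open>\<partial>D\<^sub>i\<close> the one over the complex conjugate of \<open>\<partial>D\<^sub>i\<close> gives twice the
  \<open>N\<close>-integral. These two cycles together are null-homologous in the domain of \<open>f\<close> minus the spectrum,
  so Cauchy's theorem makes the integral of \<open>N\<close> vanish. The general case follows by splitting \<open>f\<close> into
  intrinsic components.\<close>

section \<open>A separating functional\<close>

text \<open>Two obstacles shape the argument. Valid paths need not be rectifiable, and the parts
  \<open>P\<close> and \<open>N\<close> are not holomorphic in \<open>s\<close>, so their
  integrability is not evident. Both are recovered from holomorphic data: with \<open>w\<close> the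
  Riesz--Dunford integrand and \<open>w'\<close> its conjugate partner, w + w' = 2 i N and P = w - i
  N, so integrability of the S-resolvent integrands comes out together with the values of the
  integrals. Moreover, nothing matches the parametrized curves of \<Gamma> with their conjugates;
  only winding numbers are known. Substituting the conjugate variable is therefore replaced by a
  homological argument: about a point of the spectrum \<Gamma> winds once and its conjugate minus
  once. That argument needs Cauchy's theorem for cycles whose curves may lie in different components
  of the domain, and for operator-valued functions. The first is reached one component at a time,
  the second by testing with bounded complex linear functionals. Such functionals must separate
  points, which is the reason for the Hahn--Banach type result.\<close>

definition sublinear :: "('a::real_vector \<Rightarrow> real) \<Rightarrow> bool" where
  "sublinear p \<longleftrightarrow> (\<forall>x y. p (x + y) \<le> p x + p y) \<and> (\<forall>t\<ge>0. \<forall>x. p (t *\<^sub>R x) = t * p x)"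

lemma sublinear_add: "sublinear p \<Longrightarrow> p (x + y) \<le> p x + p y"
  by (simp add: sublinear_def)

lemma sublinear_scale: "sublinear p \<Longrightarrow> 0 \<le> t \<Longrightarrow> p (t *\<^sub>R x) = t * p x"
  by (simp add: sublinear_def)

lemma sublinear_zero: "sublinear p \<Longrightarrow> p 0 = 0"
  using sublinear_scale[of p 0 0] by simp

lemma sublinear_minus: "sublinear p \<Longrightarrow> - p (- x) \<le> p x"
  using sublinear_add[of p x "- x"] by (simp add: sublinear_zero)

text \<open>The scaling inequality for 1/t, applied to t x, is the reverse inequality for t, so one
  direction suffices; t = 0 is covered by \<open>p 0 = 0\<close>.\<close>

lemma sublinearI:
  assumes "\<And>x y. p (x + y) \<le> p x + p y" and "\<And>t x. 0 < t \<Longrightarrow> p (t *\<^sub>R x) \<le> t * p x" and "p 0 = 0"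
  shows "sublinear p"
proof -
  have "p (t *\<^sub>R x) = t * p x" if "0 \<le> t" for t x
  proof (cases "t = 0")
    case False
    with that have t: "t > 0" by simp
    have "p (inverse t *\<^sub>R t *\<^sub>R x) \<le> inverse t * p (t *\<^sub>R x)"
      using t by (intro assms(2)) simp
    then have "t * p x \<le> p (t *\<^sub>R x)"
      using t by (simp add: field_simps)
    with assms(2)[OF t, of x] show ?thesis by simp
  qed (use assms(3) in simp)
  with assms(1) show ?thesis by (simp add: sublinear_def)
qed

text \<open>This minorant of \<open>p\<close> is pushed down in the direction -y: the choice x = -y,
  t = 1 bounds its value there by -p(y). A minimal functional agrees with its shift and so is
  odd.\<close>

definition sublinear_shift :: "('a::real_vector \<Rightarrow> real) \<Rightarrow> 'a \<Rightarrow> 'a \<Rightarrow> real" where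
  "sublinear_shift p y x = (INF t\<in>{0..}. p (x + t *\<^sub>R y) - t * p y)"

lemma sublinear_shift_bdd:
  assumes "sublinear p"
  shows "bdd_below ((\<lambda>t. p (x + t *\<^sub>R y) - t * p y) ` {0..})"
proof (rule bdd_belowI2)
  fix t :: real assume "t \<in> {0..}"
  then have "t * p y \<le> p (x + t *\<^sub>R y) + p (- x)"
    using sublinear_add[OF assms, of "x + t *\<^sub>R y" "- x"] by (simp add: sublinear_scale[OF assms])
  then show "- p (- x) \<le> p (x + t *\<^sub>R y) - t * p y" by simp
qed

lemma sublinear_shift_le:
  assumes "sublinear p" "0 \<le> t"
  shows "sublinear_shift p y x \<le> p (x + t *\<^sub>R y) - t * p y"
  unfolding sublinear_shift_def using assms by (intro cINF_lower sublinear_shift_bdd) auto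

lemma sublinear_shift_ge:
  assumes "\<And>t. 0 \<le> t \<Longrightarrow> c \<le> p (x + t *\<^sub>R y) - t * p y"
  shows "c \<le> sublinear_shift p y x"
  unfolding sublinear_shift_def using assms by (intro cINF_greatest) auto

text \<open>Parameters s for \<open>a\<close> and t for \<open>b\<close> combine to the competitor s
  + t for \<open>a + b\<close>, and t for \<open>x\<close> becomes r t for the r-fold of
  \<open>x\<close>.\<close>

lemma sublinear_shift_sublinear:
  assumes p: "sublinear p"
  shows "sublinear (sublinear_shift p y)"
proof (rule sublinearI)
  fix a b
  have "sublinear_shift p y (a + b) - (p (b + t *\<^sub>R y) - t * p y) \<le> sublinear_shift p y a"
    if t: "0 \<le> t" for t
  proof (rule sublinear_shift_ge)
    fix s :: real assume s: "0 \<le> s"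
    have "sublinear_shift p y (a + b) \<le> p (a + b + (s + t) *\<^sub>R y) - (s + t) * p y"
      using p s t by (intro sublinear_shift_le) auto
    also have "p (a + b + (s + t) *\<^sub>R y) \<le> p (a + s *\<^sub>R y) + p (b + t *\<^sub>R y)"
      using sublinear_add[OF p, of "a + s *\<^sub>R y" "b + t *\<^sub>R y"] by (simp add: algebra_simps)
    finally show "sublinear_shift p y (a + b) - (p (b + t *\<^sub>R y) - t * p y)
        \<le> p (a + s *\<^sub>R y) - s * p y"
      by (simp add: algebra_simps)
  qed
  then have "sublinear_shift p y (a + b) - sublinear_shift p y a \<le> sublinear_shift p y b"
    by (intro sublinear_shift_ge) (simp add: algebra_simps)
  then show "sublinear_shift p y (a + b) \<le> sublinear_shift p y a + sublinear_shift p y b" by simp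
next
  fix r :: real and x assume r: "0 < r"
  have "sublinear_shift p y (r *\<^sub>R x) / r \<le> sublinear_shift p y x"
  proof (rule sublinear_shift_ge)
    fix t :: real assume t: "0 \<le> t"
    have "sublinear_shift p y (r *\<^sub>R x) \<le> p (r *\<^sub>R x + (r * t) *\<^sub>R y) - (r * t) * p y"
      using p r t by (intro sublinear_shift_le) auto
    also have "p (r *\<^sub>R x + (r * t) *\<^sub>R y) = r * p (x + t *\<^sub>R y)"
      using sublinear_scale[OF p, of r "x + t *\<^sub>R y"] r by (simp add: algebra_simps)
    finally show "sublinear_shift p y (r *\<^sub>R x) / r \<le> p (x + t *\<^sub>R y) - t * p y"
      using r by (simp add: field_simps)
  qed
  then show "sublinear_shift p y (r *\<^sub>R x) \<le> r * sublinear_shift p y x"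
    using r by (simp add: field_simps)
next
  show "sublinear_shift p y 0 = 0"
  proof (rule order_antisym)
    show "sublinear_shift p y 0 \<le> 0"
      using sublinear_shift_le[OF p, of 0 y 0] by (simp add: sublinear_zero[OF p])
    show "0 \<le> sublinear_shift p y 0"
      by (rule sublinear_shift_ge) (simp add: sublinear_scale[OF p])
  qed
qed

text \<open>Zorn's lemma for the reversed pointwise order. A nonempty chain is bounded by its
  pointwise infimum, which is finite because every member is at least -p(-x) at x.\<close>

lemma minimal_sublinear_exists:
  assumes p: "sublinear p"
  obtains q where "sublinear q" "q \<le> p" "\<And>r. sublinear r \<Longrightarrow> r \<le> q \<Longrightarrow> r = q"
proof -
  let ?A = "{q. sublinear q \<and> q \<le> p}" and ?P = "\<lambda>q r :: 'a \<Rightarrow> real. r \<le> q"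
  have "\<exists>q\<in>?A. \<forall>r\<in>?A. ?P q r \<longrightarrow> r = q"
  proof (rule predicate_Zorn)
    show "partial_order_on ?A (relation_of ?P ?A)"
      by (rule partial_order_on_relation_ofI) auto
    fix C assume C: "C \<in> Chains (relation_of ?P ?A)"
    have CA: "q \<in> ?A" if "q \<in> C" for q
      using C that by (force simp: Chains_def relation_of_def)
    have lin: "q \<le> r \<or> r \<le> q" if "q \<in> C" "r \<in> C" for q r
      using C that by (force simp: Chains_def relation_of_def)
    show "\<exists>u\<in>?A. \<forall>a\<in>C. ?P a u"
    proof (cases "C = {}")
      case False
      define u where "u x = (INF q\<in>C. q x)" for x
      have bdd: "bdd_below ((\<lambda>q. q x) ` C)" for x
      proof (rule bdd_belowI2)
        fix q assume "q \<in> C"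
        then have "sublinear q" "q (- x) \<le> p (- x)" using CA by (auto simp: le_fun_def)
        then show "- p (- x) \<le> q x" using sublinear_minus[of q x] by linarith
      qed
      have ule: "u x \<le> q x" if "q \<in> C" for q x
        unfolding u_def using bdd that by (rule cINF_lower)
      have uge: "c \<le> u x" if "\<And>q. q \<in> C \<Longrightarrow> c \<le> q x" for c x
        unfolding u_def using False that by (rule cINF_greatest)
      have "sublinear u"
      proof (rule sublinearI)
        fix x y
        have "u (x + y) - r y \<le> u x" if r: "r \<in> C" for r
        proof (rule uge)
          fix q assume q: "q \<in> C"
          \<comment> \<open>Two different members of the chain occur on the right; the smaller of
            the two serves for both arguments, and its own subadditivity applies.\<close>
          have "u (x + y) \<le> q x + r y"
          proof (cases "q \<le> r")
            case True
            then show ?thesis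
              using ule[OF q, of "x + y"] sublinear_add[of q x y] CA[OF q]
              by (auto dest!: le_funD[of q r y])
          next
            case False
            then have "r \<le> q" using lin q r by blast
            then show ?thesis
              using ule[OF r, of "x + y"] sublinear_add[of r x y] CA[OF r]
              by (auto dest!: le_funD[of r q x])
          qed
          then show "u (x + y) - r y \<le> q x" by simp
        qed
        then have "u (x + y) - u x \<le> u y" by (intro uge) (simp add: algebra_simps)
        then show "u (x + y) \<le> u x + u y" by simp
      next
        fix t :: real and x assume t: "0 < t"
        have "u (t *\<^sub>R x) / t \<le> u x"
        proof (rule uge)
          fix q assume q: "q \<in> C"
          then show "u (t *\<^sub>R x) / t \<le> q x"
            using ule[OF q, of "t *\<^sub>R x"] sublinear_scale[of q t x] CA[OF q] t
            by (simp add: field_simps)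
        qed
        then show "u (t *\<^sub>R x) \<le> t * u x" using t by (simp add: field_simps)
      next
        from False obtain q where "q \<in> C" by blast
        moreover have "0 \<le> u 0" using CA by (intro uge) (simp add: sublinear_zero)
        ultimately show "u 0 = 0" using ule[of q 0] CA[of q] by (simp add: sublinear_zero order_antisym)
      qed
      moreover have "u \<le> p"
        using False CA ule by (fastforce simp: le_fun_def intro: order_trans)
      ultimately show ?thesis using ule by (auto simp: le_fun_def)
    qed (use p in auto)
  qed
  then obtain q where q: "sublinear q" "q \<le> p"
    and min: "\<And>r. sublinear r \<Longrightarrow> r \<le> p \<Longrightarrow> r \<le> q \<Longrightarrow> r = q" by blast
  show thesis
    using q by (rule that) (rule min, auto intro: order_trans[OF _ q(2)])
qed

text \<open>A sublinear functional that is minimal in the pointwise order is linear, since replacing it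
  by any of its shifts cannot decrease it; hence no extension from subspaces is needed.\<close>

theorem separating_functional_exists:
  fixes x0 :: "'a::real_normed_vector"
  assumes "x0 \<noteq> 0"
  obtains \<phi> :: "'a \<Rightarrow> real" where "bounded_linear \<phi>" "\<phi> x0 \<noteq> 0"
proof -
  have n: "sublinear (norm :: 'a \<Rightarrow> real)"
    by (rule sublinearI) (simp_all add: norm_triangle_ineq)
  \<comment> \<open>Minimizing below the shift of the norm, rather than below the norm itself,
    forces q(-x0) to be at most -|x0|, so that \<open>q\<close> cannot vanish at
    \<open>x0\<close>.\<close>
  obtain q where q: "sublinear q" "q \<le> sublinear_shift norm x0"
    and min: "\<And>r. sublinear r \<Longrightarrow> r \<le> q \<Longrightarrow> r = q"
    using minimal_sublinear_exists[OF sublinear_shift_sublinear[OF n, of x0]] by blast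
  have odd: "q (- y) = - q y" for y
  proof -
    have "sublinear_shift q y \<le> q"
      using sublinear_shift_le[OF q(1), of 0 y] by (simp add: le_fun_def)
    then have "sublinear_shift q y = q" using sublinear_shift_sublinear[OF q(1)] min by blast
    then have "q (- y) \<le> - q y"
      using sublinear_shift_le[OF q(1), of 1 y "- y"] by (simp add: sublinear_zero[OF q(1)])
    moreover have "- q y \<le> q (- y)" using sublinear_minus[OF q(1), of "- y"] by simp
    ultimately show ?thesis by simp
  qed
  have qn: "q x \<le> norm x" for x
    using sublinear_shift_le[OF n, of 0 x0 x] q(2) by (auto simp: le_fun_def intro: order_trans)
  have "bounded_linear q"
  proof (rule bounded_linear_intro[where K = 1])
    fix x y
    show "q (x + y) = q x + q y"
      using sublinear_add[OF q(1), of x y] sublinear_add[OF q(1), of "x + y" "- y"]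
      by (simp add: odd)
  next
    fix r x
    show "q (r *\<^sub>R x) = r *\<^sub>R q x"
      using sublinear_scale[OF q(1), of r x] sublinear_scale[OF q(1), of "- r" x] odd[of "r *\<^sub>R x"]
      by (cases "0 \<le> r") auto
  next
    fix x
    show "norm (q x) \<le> norm x * 1" using qn[of x] qn[of "- x"] by (simp add: odd)
  qed
  moreover have "q x0 \<noteq> 0"
  proof -
    have "q (- x0) \<le> sublinear_shift norm x0 (- x0)" using q(2) by (simp add: le_fun_def)
    also have "\<dots> \<le> - norm x0" using sublinear_shift_le[OF n, of 1 x0 "- x0"] by simp
    finally have "norm x0 \<le> q x0" by (simp add: odd)
    then show ?thesis using assms by auto
  qed
  ultimately show thesis using that by blast
qed

section \<open>Cauchy's theorem for cycles\<close>

text \<open>Each closed curve is reached from \<open>a\<close> by a connecting path inside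
  \<open>C\<close> and left along the reversed path; the two traversals cancel in every integral.
  This turns a cycle in a connected set into a single closed path.\<close>

lemma join_closed_paths:
  fixes p :: "'i \<Rightarrow> real \<Rightarrow> complex"
  assumes "finite I" and C: "open C" "connected C" "a \<in> C"
    and p: "\<And>k. k \<in> I \<Longrightarrow> valid_path (p k) \<and> pathfinish (p k) = pathstart (p k) \<and> path_image (p k) \<subseteq> C"
  obtains q where "valid_path q" "pathstart q = a" "pathfinish q = a" "path_image q \<subseteq> C"
    "\<And>f. f holomorphic_on C \<Longrightarrow> contour_integral q f = (\<Sum>k\<in>I. contour_integral (p k) f)"
proof -
  have "\<exists>q. valid_path q \<and> pathstart q = a \<and> pathfinish q = a \<and> path_image q \<subseteq> C \<and>
    (\<forall>f. f holomorphic_on C \<longrightarrow> contour_integral q f = (\<Sum>k\<in>I. contour_integral (p k) f))"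
    using assms(1) p
  proof (induction I)
    case empty
    have "path_image (linepath a a) \<subseteq> C" using C(3) by simp
    then show ?case
      by (intro exI[of _ "linepath a a"] conjI allI impI)
        (simp_all only: sum.empty valid_path_linepath pathstart_linepath pathfinish_linepath
          contour_integral_trivial)
  next
    case (insert k I)
    then obtain q where q: "valid_path q" "pathstart q = a" "pathfinish q = a" "path_image q \<subseteq> C"
      "\<And>f. f holomorphic_on C \<Longrightarrow> contour_integral q f = (\<Sum>k\<in>I. contour_integral (p k) f)"
      by (metis insertCI)
    have k: "valid_path (p k)" "pathfinish (p k) = pathstart (p k)" "path_image (p k) \<subseteq> C"
      using insert.prems by auto
    then have "pathstart (p k) \<in> C" by blast
    then obtain g where "polynomial_function g" and
      g': "path_image g \<subseteq> C" "pathstart g = a" "pathfinish g = pathstart (p k)"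
      using connected_open_polynomial_connected[OF C(1,2) C(3)] by metis
    then have g: "valid_path g" by (simp add: valid_path_polynomial_function)
    define q' where "q' = q +++ (g +++ (p k +++ reversepath g))"
    have "contour_integral q' f = (\<Sum>k\<in>insert k I. contour_integral (p k) f)"
      if f: "f holomorphic_on C" for f
    proof -
      have ci: "f contour_integrable_on r" if "valid_path r" "path_image r \<subseteq> C" for r
        using f C(1) that by (rule contour_integrable_holomorphic_simple)
      show ?thesis
        unfolding q'_def using q k g g' f insert.hyps
        by (simp add: ci path_image_join contour_integral_reversepath)
    qed
    moreover have "valid_path q'" "pathstart q' = a" "pathfinish q' = a" "path_image q' \<subseteq> C"
      unfolding q'_def using q k g g' by (auto simp: path_image_join)
    ultimately show ?case by blast
  qed
  then show thesis using that by blast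
qed

text \<open>A component missing the frontier would also be a component of the open set
  \<open>- closure C\<close>, hence open as well as closed. It would then be empty or everything,
  yet it contains \<open>w\<close> and misses the nonempty \<open>C\<close>.\<close>

lemma component_of_complement_meets_frontier:
  fixes C :: "'a::real_normed_vector set"
  assumes "open C" "C \<noteq> {}" "w \<notin> C"
  obtains b where "b \<in> frontier C" "b \<in> connected_component_set (- C) w"
proof -
  let ?K = "connected_component_set (- C) w"
  have "?K \<inter> frontier C \<noteq> {}"
  proof
    assume K: "?K \<inter> frontier C = {}"
    have sub: "?K \<subseteq> - closure C"
      using K connected_component_subset[of "- C" w] assms(1)
      by (auto simp: frontier_def interior_open)
    have w: "w \<in> ?K" using assms(3) by simp
    have "?K \<subseteq> connected_component_set (- closure C) w"
      using w sub by (intro connected_component_maximal) auto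
    moreover have "connected_component_set (- closure C) w \<subseteq> ?K"
      by (intro connected_component_mono) (use closure_subset in blast)
    ultimately have "?K = connected_component_set (- closure C) w" by blast
    moreover have "open (connected_component_set (- closure C) w)"
      by (rule open_connected_component) blast
    ultimately have "open ?K" by simp
    moreover have "closed ?K" using assms(1) by (intro closed_connected_component) auto
    ultimately have "?K = {} \<or> ?K = UNIV" by (metis clopen)
    then show False using w assms(2) connected_component_subset[of "- C" w] by blast
  qed
  then show thesis using that by blast
qed

text \<open>The total winding number about points outside \<open>V\<close> also vanishes for the curves within a single
  component \<open>C\<close> of \<open>V\<close>: the curves outside \<open>C\<close> contribute a constant on \<open>closure C\<close>, and this constant is
  zero, as a look at a point of \<open>closure C\<close> far from the origin shows.\<close>

lemma winding_number_zero_off_component: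
  fixes p :: "'i \<Rightarrow> real \<Rightarrow> complex"
  assumes I: "finite I" and V: "open V"
    and p: "\<And>k. k \<in> I \<Longrightarrow> path (p k) \<and> pathfinish (p k) = pathstart (p k) \<and> path_image (p k) \<subseteq> V"
    and zero: "\<And>w. w \<notin> V \<Longrightarrow> (\<Sum>k\<in>I. winding_number (p k) w) = 0"
    and C: "C = connected_component_set V x" "C \<noteq> {}"
    and J: "J = {k \<in> I. path_image (p k) \<subseteq> C}"
    and w: "w \<notin> C"
  shows "(\<Sum>k\<in>J. winding_number (p k) w) = 0"
proof -
  have oC: "open C" and conC: "connected C" using C V by (auto simp: open_connected_component)
  have fr: "b \<notin> V" "b \<in> closure C" "b \<notin> C" if "b \<in> frontier C" for b
    using that frontier_of_connected_component_subset[of V x] V oC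
    by (auto simp: C(1) frontier_def interior_open)
  have JI: "J \<subseteq> I" using J by blast
  have off: "closure C \<inter> path_image (p k) = {}" if k: "k \<in> I - J" for k
  proof -
    let ?D = "connected_component_set V (pathstart (p k))"
    have s: "pathstart (p k) \<in> path_image (p k)" by (rule pathstart_in_path_image)
    have "path_image (p k) \<subseteq> ?D"
      using p[of k] k s by (intro connected_component_maximal) (auto intro: connected_path_image)
    moreover have "?D \<inter> C = {}"
    proof (rule ccontr)
      assume "?D \<inter> C \<noteq> {}"
      then have "?D = C" unfolding C(1) using connected_component_overlap[of V "pathstart (p k)" x]
        by (auto simp: Int_commute)
      then show False using \<open>path_image (p k) \<subseteq> ?D\<close> k J by blast
    qed
    moreover have "open ?D" using V by (simp add: open_connected_component)
    ultimately show ?thesis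
      using open_Int_closure_eq_empty[of ?D C] by blast
  qed
  have const: "winding_number (p k) y = winding_number (p k) z"
    if "k \<in> I - J" "y \<in> closure C" "z \<in> closure C" for k y z
  proof -
    have "winding_number (p k) constant_on closure C"
      using p[of k] that off[of k] conC
      by (intro winding_number_constant) (auto intro: connected_imp_connected_closure)
    then show ?thesis using that by (metis constant_on_def)
  qed
  have bd: "(\<Sum>k\<in>J. winding_number (p k) b) = - (\<Sum>k\<in>I - J. winding_number (p k) b)"
    if "b \<in> frontier C" for b
    using zero[OF fr(1)[OF that]] sum.subset_diff[OF JI I, of "\<lambda>k. winding_number (p k) b"]
    by (simp add: add_eq_0_iff)
  have other: "(\<Sum>k\<in>I - J. winding_number (p k) y) = 0" if y: "y \<in> closure C" for y
  proof (cases "bounded C")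
    case True
    then have "compact (closure C)" by (simp add: compact_closure)
    \<comment> \<open>A point of largest norm in \<open>closure C\<close> lies on the frontier,
      hence outside \<open>V\<close>. The open ball of radius |b| contains \<open>C\<close> and so
      the curves of \<open>J\<close>, none of which winds about \<open>b\<close>; then
      \<open>bd\<close> makes the contribution of the other curves zero.\<close>
    then obtain b where b: "b \<in> closure C" and max: "\<And>z. z \<in> closure C \<Longrightarrow> norm z \<le> norm b"
      using continuous_attains_sup[OF _ _ continuous_on_norm_id, of "closure C"] y by (metis empty_iff)
    have "C \<subseteq> cball 0 (norm b)" using max closure_subset[of C] by (auto simp: subset_iff)
    from interior_maximal[OF this oC] have Cb: "C \<subseteq> ball 0 (norm b)"
      unfolding interior_cball .
    have "b \<notin> C" using subsetD[OF Cb, of b] by auto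
    then have "b \<in> frontier C" using b oC by (simp add: frontier_def interior_open)
    moreover have "winding_number (p k) b = 0" if "k \<in> J" for k
      using p[of k] that J Cb
      by (intro winding_number_zero_outside[where s = "ball 0 (norm b)"]) auto
    ultimately have "(\<Sum>k\<in>I - J. winding_number (p k) b) = 0" using bd[of b] by simp
    then show ?thesis using const[OF _ y b] by simp
  next
    case False
    have "winding_number (p k) y = 0" if k: "k \<in> I - J" for k
    proof -
      obtain r where r: "path_image (p k) \<subseteq> ball 0 r"
        using p[of k] k bounded_path_image[of "p k"] by (metis DiffD1 bounded_subset_ballD)
      obtain z where z: "z \<in> C" "z \<notin> ball 0 r"
        using False bounded_subset[OF bounded_ball, of C 0 r] by blast
      have "winding_number (p k) z = 0"
        using p[of k] k r z by (intro winding_number_zero_outside[where s = "ball 0 r"]) auto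
      then show ?thesis using const[OF k y, of z] z closure_subset[of C] by (auto simp: subset_iff)
    qed
    then show ?thesis by simp
  qed
  \<comment> \<open>The point \<open>w\<close> may be anywhere outside \<open>C\<close>. Within its
    component of \<open>- C\<close> the winding numbers of the curves in \<open>J\<close> are
    constant, so \<open>w\<close> may be moved to the frontier, where \<open>bd\<close> and
    \<open>other\<close> apply.\<close>
  obtain b where b: "b \<in> frontier C" "b \<in> connected_component_set (- C) w"
    using component_of_complement_meets_frontier[OF oC C(2) w] .
  have "winding_number (p k) w = winding_number (p k) b" if "k \<in> J" for k
  proof -
    have "winding_number (p k) constant_on connected_component_set (- C) w"
      using p[of k] that J connected_component_subset[of "- C" w]
      by (intro winding_number_constant) auto
    moreover have "w \<in> connected_component_set (- C) w" using w by simp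
    ultimately show ?thesis using b(2) by (metis constant_on_def)
  qed
  then show ?thesis using bd[OF b(1)] other[OF fr(2)[OF b(1)]] by simp
qed

text \<open>Curves in different components of \<open>V\<close> cannot be joined inside
  \<open>V\<close>, so the sum is grouped by component. Within one component the curves are merged
  into one closed path, to which the homology form of Cauchy's theorem for a single path
  applies.\<close>

theorem Cauchy_theorem_cycle:
  fixes p :: "'i \<Rightarrow> real \<Rightarrow> complex"
  assumes I: "finite I" and V: "open V" and f: "f holomorphic_on V"
    and p: "\<And>k. k \<in> I \<Longrightarrow> valid_path (p k) \<and> pathfinish (p k) = pathstart (p k) \<and> path_image (p k) \<subseteq> V"
    and zero: "\<And>w. w \<notin> V \<Longrightarrow> (\<Sum>k\<in>I. winding_number (p k) w) = 0"
  shows "(\<Sum>k\<in>I. contour_integral (p k) f) = 0"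
proof -
  define comp where "comp k = connected_component_set V (pathstart (p k))" for k
  have pc: "path_image (p k) \<subseteq> comp k" if "k \<in> I" for k
    unfolding comp_def using p[OF that] pathstart_in_path_image[of "p k"]
    by (intro connected_component_maximal) (auto intro: connected_path_image valid_path_imp_path)
  have "(\<Sum>k\<in>{k \<in> I. comp k = C}. contour_integral (p k) f) = 0" if "C \<in> comp ` I" for C
  proof -
    define J where "J = {k \<in> I. path_image (p k) \<subseteq> C}"
    obtain k0 where k0: "k0 \<in> I" "C = comp k0" using \<open>C \<in> comp ` I\<close> by auto
    have CV: "open C" "connected C" "C \<subseteq> V"
      using V by (auto simp: k0 comp_def open_connected_component connected_component_subset)
    have start: "pathstart (p k) \<in> comp k" if "k \<in> I" for k
      using pc[OF that] by blast
    have "comp k = C" if "k \<in> I" "path_image (p k) \<subseteq> C" for k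
    proof -
      have "pathstart (p k) \<in> C" using that by blast
      then show ?thesis unfolding k0 comp_def using connected_component_eq by metis
    qed
    then have J: "{k \<in> I. comp k = C} = J" using pc by (auto simp: J_def)
    have fJ: "finite J" using I by (simp add: J_def)
    have "k \<in> J \<Longrightarrow> valid_path (p k) \<and> pathfinish (p k) = pathstart (p k) \<and> path_image (p k) \<subseteq> C" for k
      using p by (simp add: J_def)
    then obtain q where q: "valid_path q" "pathfinish q = pathstart q" "path_image q \<subseteq> C"
      and int: "\<And>f. f holomorphic_on C \<Longrightarrow> contour_integral q f = (\<Sum>k\<in>J. contour_integral (p k) f)"
      using join_closed_paths[OF fJ CV(1,2), of "pathstart (p k0)" p] start k0 by metis
    \<comment> \<open>A winding number is itself an integral, of 1/(z - w), so that of
      \<open>q\<close> is the sum over the merged curves. Here \<open>w\<close> may lie in another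
      component of \<open>V\<close>, where the hypothesis \<open>zero\<close> says nothing
      directly.\<close>
    have "winding_number q w = 0" if w: "w \<notin> C" for w
    proof -
      have "(\<lambda>z. 1 / (z - w)) holomorphic_on C" using w by (auto intro!: holomorphic_intros)
      then have "winding_number q w
          = (\<Sum>k\<in>J. 1 / (2 * pi * \<i>) * contour_integral (p k) (\<lambda>z. 1 / (z - w)))"
        using q w by (subst winding_number_valid_path) (auto simp: int sum_distrib_left)
      also have "\<dots> = (\<Sum>k\<in>J. winding_number (p k) w)"
      proof (rule sum.cong)
        fix k assume "k \<in> J"
        then show "1 / (2 * pi * \<i>) * contour_integral (p k) (\<lambda>z. 1 / (z - w)) = winding_number (p k) w"
          using p w by (subst winding_number_valid_path) (auto simp: J_def)
      qed simp
      also have "\<dots> = 0"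
      proof (rule winding_number_zero_off_component[OF I V _ zero _ _ J_def w])
        show "C = connected_component_set V (pathstart (p k0))" by (simp add: k0 comp_def)
        show "C \<noteq> {}" using start k0 by blast
      qed (use p valid_path_imp_path in blast)+
      finally show ?thesis .
    qed
    then have "(f has_contour_integral 0) q"
      using q CV f by (intro Cauchy_theorem_global[of C]) (auto intro: holomorphic_on_subset)
    then show ?thesis
      using int[of f] f CV(3) by (simp add: J contour_integral_unique holomorphic_on_subset)
  qed
  then show ?thesis
    using sum.image_gen[OF I, of "\<lambda>k. contour_integral (p k) f" comp] by simp
qed

section \<open>Vector-valued holomorphic functions\<close>

lemma contour_integral_within:
  "contour_integral \<gamma> f = integral {0..1} (\<lambda>t. f (\<gamma> t) * vector_derivative \<gamma> (at t within {0..1}))"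
  by (simp add: contour_integral_def integral_def has_contour_integral_def contour_integrable_on_def
      integrable_on_def)

lemma valid_path_has_vector_derivative:
  assumes "valid_path \<gamma>"
  obtains S where "finite S"
    "\<And>t. t \<in> {0..1} - S \<Longrightarrow> (\<gamma> has_vector_derivative vector_derivative \<gamma> (at t within {0..1})) (at t)"
proof -
  obtain S where S: "finite S" "\<gamma> C1_differentiable_on ({0..1} - S)"
    using assms unfolding valid_path_def piecewise_C1_differentiable_on_def by blast
  then obtain D where D: "\<And>t. t \<in> {0..1} - S \<Longrightarrow> (\<gamma> has_vector_derivative D t) (at t)"
    unfolding C1_differentiable_on_def by blast
  then have "vector_derivative \<gamma> (at t within {0..1}) = D t" if "t \<in> {0..1} - S" for t
    using that by (intro vector_derivative_at_within_ivl) auto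
  with D S(1) show thesis by (intro that[of S]) auto
qed

text \<open>A complex structure on a real Banach space, kept as an explicit operation because one
  and the same operator space carries a different one for each choice of \<open>i\<close>.\<close>

locale complex_action = bounded_bilinear cs
  for cs :: "complex \<Rightarrow> 'e::banach \<Rightarrow> 'e" +
  assumes cs_one: "cs 1 x = x"
    and cs_mult: "cs (a * b) x = cs a (cs b x)"
begin

lemma cs_eq: "cs a x = Re a *\<^sub>R x + Im a *\<^sub>R cs \<i> x"
proof -
  have "a = Re a *\<^sub>R 1 + Im a *\<^sub>R \<i>" by (simp add: complex_eq_iff)
  then show ?thesis by (metis add_left scaleR_left cs_one)
qed

definition clinear_functional :: "('e \<Rightarrow> complex) \<Rightarrow> bool" where
  "clinear_functional \<Phi> \<longleftrightarrow> bounded_linear \<Phi> \<and> (\<forall>a x. \<Phi> (cs a x) = a * \<Phi> x)"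

text \<open>From a real functional \<phi> that separates \<open>x\<close> and \<open>y\<close>, the
  map z to \<phi>(z) - i \<phi>(i z) is complex linear and has real part \<phi>.\<close>

lemma eq_if_clinear_functionals_eq:
  assumes "\<And>\<Phi>. clinear_functional \<Phi> \<Longrightarrow> \<Phi> x = \<Phi> y"
  shows "x = y"
proof (rule ccontr)
  assume "x \<noteq> y"
  then obtain \<phi> :: "'e \<Rightarrow> real" where \<phi>: "bounded_linear \<phi>" "\<phi> (x - y) \<noteq> 0"
    using separating_functional_exists[of "x - y"] by auto
  define \<Phi> where "\<Phi> z = of_real (\<phi> z) - \<i> * of_real (\<phi> (cs \<i> z))" for z
  interpret \<phi>: bounded_linear \<phi> by fact
  have "bounded_linear (\<lambda>z. \<phi> (cs \<i> z))"
    by (rule bounded_linear_compose[OF \<phi>(1) bounded_linear_right])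
  then have "bounded_linear \<Phi>"
    unfolding \<Phi>_def
    by (intro bounded_linear_sub bounded_linear_compose[OF bounded_linear_of_real] \<phi>(1)
        bounded_linear_const_mult)
  moreover have "\<Phi> (cs a z) = a * \<Phi> z" for a z
  proof -
    have "cs \<i> (cs \<i> z) = - z"
      by (simp flip: cs_mult) (simp add: minus_left cs_one)
    moreover have "cs \<i> (cs a z) = Re a *\<^sub>R cs \<i> z + Im a *\<^sub>R cs \<i> (cs \<i> z)"
      by (subst cs_eq[of a]) (simp add: add_right scaleR_right)
    moreover have "cs a z = Re a *\<^sub>R z + Im a *\<^sub>R cs \<i> z" by (rule cs_eq)
    ultimately have "\<phi> (cs a z) = Re a * \<phi> z + Im a * \<phi> (cs \<i> z)"
      "\<phi> (cs \<i> (cs a z)) = Re a * \<phi> (cs \<i> z) - Im a * \<phi> z"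
      by (simp_all only: \<phi>.add \<phi>.neg \<phi>.scaleR) simp_all
    then show ?thesis by (simp add: \<Phi>_def complex_eq_iff)
  qed
  ultimately have "clinear_functional \<Phi>" unfolding clinear_functional_def by blast
  then have "\<Phi> (x - y) = 0"
    using assms[of \<Phi>] by (simp add: clinear_functional_def linear_diff bounded_linear.linear)
  then show False using \<phi>(2) by (simp add: \<Phi>_def complex_eq_iff)
qed

text \<open>Continuity is asked in norm, because it controls the difference quotients of a
  vector-valued primitive; holomorphy is asked only after applying functionals, where the scalar
  theorems are available.\<close>

definition weakly_holomorphic :: "(complex \<Rightarrow> 'e) \<Rightarrow> complex set \<Rightarrow> bool" where
  "weakly_holomorphic H V \<longleftrightarrow>
     continuous_on V H \<and> (\<forall>\<Phi>. clinear_functional \<Phi> \<longrightarrow> (\<lambda>z. \<Phi> (H z)) holomorphic_on V)"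

definition segment_integral :: "(complex \<Rightarrow> 'e) \<Rightarrow> complex \<Rightarrow> complex \<Rightarrow> 'e" where
  "segment_integral H a b = cs (b - a) (integral {0..1} (\<lambda>t. H (linepath a b t)))"

lemma clinear_functional_segment_integral:
  assumes "clinear_functional \<Phi>" "continuous_on (closed_segment a b) H"
  shows "\<Phi> (segment_integral H a b) = contour_integral (linepath a b) (\<lambda>z. \<Phi> (H z))"
proof -
  have "continuous_on {0..1} (H \<circ> linepath a b)"
    using assms(2) by (intro continuous_on_compose continuous_on_linepath) (simp flip: path_image_def)
  then have "(\<lambda>t. H (linepath a b t)) integrable_on {0..1}"
    by (intro integrable_continuous_real) (simp add: o_def)
  then have "integral {0..1} (\<lambda>t. \<Phi> (H (linepath a b t))) = \<Phi> (integral {0..1} (\<lambda>t. H (linepath a b t)))"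
    using integral_linear[of "\<lambda>t. H (linepath a b t)" "{0..1}" \<Phi>] assms(1)
    by (simp add: o_def clinear_functional_def)
  then show ?thesis
    using assms(1) unfolding segment_integral_def contour_integral_integral clinear_functional_def
    by (simp add: mult.commute)
qed

text \<open>A functional turns each segment integral into a difference of values of a scalar
  primitive; these telescope, and functionals separate points.\<close>

lemma segment_integral_add:
  assumes H: "weakly_holomorphic H B" and B: "convex B" "open B" "a \<in> B" "b \<in> B" "c \<in> B"
  shows "segment_integral H a b + segment_integral H b c = segment_integral H a c"
proof (rule eq_if_clinear_functionals_eq)
  fix \<Phi> assume \<Phi>: "clinear_functional \<Phi>"
  then have "(\<lambda>z. \<Phi> (H z)) holomorphic_on B" using H by (simp add: weakly_holomorphic_def)
  then obtain g where g: "\<And>z. z \<in> B \<Longrightarrow> (g has_field_derivative \<Phi> (H z)) (at z within B)"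
    using holomorphic_convex_primitive'[OF B(1,2)] by metis
  have "\<Phi> (segment_integral H x y) = g y - g x" if "x \<in> B" "y \<in> B" for x y
  proof -
    have xy: "closed_segment x y \<subseteq> B" using that B(1) by (simp add: closed_segment_subset)
    then have "continuous_on (closed_segment x y) H"
      using H continuous_on_subset by (auto simp: weakly_holomorphic_def)
    moreover have "((\<lambda>z. \<Phi> (H z)) has_contour_integral g y - g x) (linepath x y)"
      using contour_integral_primitive[OF g, of "linepath x y"] xy by simp
    ultimately show ?thesis
      by (simp add: clinear_functional_segment_integral[OF \<Phi>] contour_integral_unique)
  qed
  moreover have "\<Phi> (x + y) = \<Phi> x + \<Phi> y" for x y
    using \<Phi> by (simp add: clinear_functional_def linear_add bounded_linear.linear)
  ultimately show "\<Phi> (segment_integral H a b + segment_integral H b c) = \<Phi> (segment_integral H a c)"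
    using B(3-5) by simp
qed

text \<open>The primitive is the integral along the segment from the centre. By additivity its
  increment from z to y is the integral over the segment from z to y, so the error is governed by
  the oscillation of \<open>H\<close> near z.\<close>

lemma has_primitive_on_ball:
  assumes H: "weakly_holomorphic H (ball z0 r)"
  obtains P where "\<And>z. z \<in> ball z0 r \<Longrightarrow> (P has_derivative (\<lambda>h. cs h (H z))) (at z)"
proof
  let ?B = "ball z0 r"
  fix z assume z: "z \<in> ?B"
  obtain K where K: "0 < K" "\<And>a x. norm (cs a x) \<le> norm a * norm x * K" using pos_bounded by blast
  have cont: "continuous_on ?B H" using H by (simp add: weakly_holomorphic_def)
  show "(segment_integral H z0 has_derivative (\<lambda>h. cs h (H z))) (at z)"
    unfolding has_derivative_at_alt
  proof (intro conjI allI impI)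
    show "bounded_linear (\<lambda>h. cs h (H z))" by (rule bounded_linear_left)
    fix e :: real assume e: "0 < e"
    have "isCont H z" using cont z by (simp add: continuous_on_eq_continuous_at)
    \<comment> \<open>The tolerance e / K compensates the bound \<open>K\<close> of the scalar
      multiplication in the final estimate.\<close>
    then obtain d1 where d1: "d1 > 0" "\<And>w. dist w z < d1 \<Longrightarrow> dist (H w) (H z) < e / K"
      using e K(1) unfolding continuous_at_eps_delta by (metis divide_pos_pos)
    obtain d2 where d2: "d2 > 0" "ball z d2 \<subseteq> ?B" using z open_ball open_contains_ball by blast
    show "\<exists>d>0. \<forall>y. norm (y - z) < d \<longrightarrow>
      norm (segment_integral H z0 y - segment_integral H z0 z - cs (y - z) (H z)) \<le> e * norm (y - z)"
    proof (intro exI[of _ "min d1 d2"] conjI allI impI)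
      fix y assume y: "norm (y - z) < min d1 d2"
      then have yB: "y \<in> ball z d1" "y \<in> ball z d2" by (auto simp: dist_norm norm_minus_commute)
      have seg: "closed_segment z y \<subseteq> ball z d1" "closed_segment z y \<subseteq> ball z d2"
        using d1(1) d2(1) yB by (simp_all add: closed_segment_subset del: mem_ball)
      have "continuous_on (linepath z y ` {0..1}) H"
        using seg(2) d2(2) by (intro continuous_on_subset[OF cont]) (auto simp: linepath_image_01)
      from continuous_on_compose[OF continuous_on_linepath this]
      have c: "continuous_on {0..1} (\<lambda>t. H (linepath z y t))" by (simp add: o_def)
      have z0: "z0 \<in> ?B" using z by (metis centre_in_ball mem_ball zero_le_dist le_less_trans)
      have "segment_integral H z0 y - segment_integral H z0 z = segment_integral H z y"
        using segment_integral_add[OF H _ _ z0 z, of y] yB d2(2) by (auto simp: algebra_simps)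
      also have "\<dots> - cs (y - z) (H z) = cs (y - z) (integral {0..1} (\<lambda>t. H (linepath z y t) - H z))"
        unfolding segment_integral_def using integrable_continuous_real[OF c]
        by (subst integral_diff) (auto simp: diff_right)
      also have "norm \<dots> \<le> norm (y - z) * norm (integral {0..1} (\<lambda>t. H (linepath z y t) - H z)) * K"
        by (rule K(2))
      also have "\<dots> \<le> norm (y - z) * (e / K * (1 - 0)) * K"
      proof (intro mult_right_mono mult_left_mono integral_bound)
        fix t :: real assume "t \<in> {0..1}"
        then have "linepath z y t \<in> closed_segment z y" by (simp add: linepath_in_path)
        then have "linepath z y t \<in> ball z d1" using seg(1) by blast
        then have "dist (H (linepath z y t)) (H z) < e / K"
          by (intro d1(2)) (simp add: dist_commute)
        then show "norm (H (linepath z y t) - H z) \<le> e / K" by (simp add: dist_norm)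
      qed (use K c in \<open>auto intro!: continuous_intros\<close>)
      also have "\<dots> = e * norm (y - z)" using K(1) by simp
      finally show "norm (segment_integral H z0 y - segment_integral H z0 z - cs (y - z) (H z))
        \<le> e * norm (y - z)" .
    qed (use d1 d2 in auto)
  qed
qed

text \<open>A valid path may fail to be rectifiable, because its derivative may be unbounded near the
  exceptional points. So integrability rests on local primitives, not on continuity of the
  integrand.\<close>

lemma weakly_holomorphic_integrable:
  assumes H: "weakly_holomorphic H V" and V: "open V" and \<gamma>: "valid_path \<gamma>" "path_image \<gamma> \<subseteq> V"
  shows "(\<lambda>t. cs (vector_derivative \<gamma> (at t within {0..1})) (H (\<gamma> t))) integrable_on {0..1}"
    (is "?h integrable_on _")
proof -
  obtain S where S: "finite S" and
    deriv: "\<And>t. t \<in> {0..1} - S \<Longrightarrow> (\<gamma> has_vector_derivative vector_derivative \<gamma> (at t within {0..1})) (at t)"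
    using valid_path_has_vector_derivative[OF \<gamma>(1)] by blast
  have cont: "continuous_on {0..1} \<gamma>" using valid_path_imp_path[OF \<gamma>(1)] by (simp add: path_def)
  have "?h integrable_on cbox 0 1"
  proof (rule integrable_on_little_subintervals, rule ballI)
    fix x :: real assume x: "x \<in> cbox 0 1"
    then have "\<gamma> x \<in> V" using \<gamma>(2) by (auto simp: path_image_def)
    then obtain r where r: "r > 0" "ball (\<gamma> x) r \<subseteq> V" using V open_contains_ball by blast
    have "weakly_holomorphic H (ball (\<gamma> x) r)"
      using H r(2) by (auto simp: weakly_holomorphic_def intro: continuous_on_subset holomorphic_on_subset)
    then obtain P where P: "\<And>z. z \<in> ball (\<gamma> x) r \<Longrightarrow> (P has_derivative (\<lambda>h. cs h (H z))) (at z)"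
      using has_primitive_on_ball by blast
    obtain d where d: "d > 0" "\<And>t. t \<in> {0..1} \<Longrightarrow> dist t x < d \<Longrightarrow> dist (\<gamma> t) (\<gamma> x) < r"
      using cont x r(1) unfolding continuous_on_iff cbox_interval by metis
    show "\<exists>d>0. \<forall>u v. x \<in> cbox u v \<and> cbox u v \<subseteq> ball x d \<and> cbox u v \<subseteq> cbox 0 1 \<longrightarrow>
      ?h integrable_on cbox u v"
    proof (intro exI[of _ d] conjI allI impI)
      fix u v assume uv: "x \<in> cbox u v \<and> cbox u v \<subseteq> ball x d \<and> cbox u v \<subseteq> cbox 0 1"
      have in_ball: "\<gamma> t \<in> ball (\<gamma> x) r" "t \<in> {0..1}" if "t \<in> {u..v}" for t
      proof -
        have "t \<in> {0..1}" "t \<in> ball x d" using uv that by auto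
        then show "\<gamma> t \<in> ball (\<gamma> x) r" "t \<in> {0..1}" using d(2)[of t] by (auto simp: dist_commute)
      qed
      \<comment> \<open>Near \<open>x\<close> the curve stays in a ball with a primitive
        \<open>P\<close>. The composite is continuous throughout and differentiable off the finite
        set \<open>S\<close>, which is all that the fundamental theorem for this integral
        asks.\<close>
      have "(?h has_integral ((P \<circ> \<gamma>) v - (P \<circ> \<gamma>) u)) {u..v}"
      proof (rule fundamental_theorem_of_calculus_strong[OF S])
        show "u \<le> v" using uv by auto
        fix t assume t: "t \<in> {u..v} - S"
        show "((P \<circ> \<gamma>) has_vector_derivative ?h t) (at t)"
          using deriv[of t] P[of "\<gamma> t"] in_ball[of t] t
          by (intro vector_derivative_diff_chain_within) (auto intro: has_derivative_at_withinI)
      next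
        have "continuous_on (ball (\<gamma> x) r) P"
          using P by (intro continuous_at_imp_continuous_on) (blast intro: has_derivative_continuous)
        moreover have "continuous_on {u..v} \<gamma>"
          using in_ball(2) by (intro continuous_on_subset[OF cont]) auto
        ultimately show "continuous_on {u..v} (P \<circ> \<gamma>)"
          using in_ball(1) by (intro continuous_on_compose) (auto intro: continuous_on_subset)
      qed
      then show "?h integrable_on cbox u v" by auto
    qed (use d in auto)
  qed
  then show ?thesis by simp
qed

text \<open>Functionals pass through the integrals because the integrands are known to be
  integrable; what remains is the scalar theorem for each functional.\<close>

theorem Cauchy_theorem_cycle_weakly_holomorphic:
  fixes p :: "'i \<Rightarrow> real \<Rightarrow> complex"
  assumes I: "finite I" and V: "open V" and H: "weakly_holomorphic H V"
    and p: "\<And>k. k \<in> I \<Longrightarrow> valid_path (p k) \<and> pathfinish (p k) = pathstart (p k) \<and> path_image (p k) \<subseteq> V"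
    and zero: "\<And>w. w \<notin> V \<Longrightarrow> (\<Sum>k\<in>I. winding_number (p k) w) = 0"
  shows "(\<Sum>k\<in>I. integral {0..1} (\<lambda>t. cs (vector_derivative (p k) (at t within {0..1})) (H (p k t)))) = 0"
proof (rule eq_if_clinear_functionals_eq)
  fix \<Phi> assume \<Phi>: "clinear_functional \<Phi>"
  interpret \<Phi>: bounded_linear \<Phi> using \<Phi> by (simp add: clinear_functional_def)
  have "\<Phi> (\<Sum>k\<in>I. integral {0..1} (\<lambda>t. cs (vector_derivative (p k) (at t within {0..1})) (H (p k t))))
      = (\<Sum>k\<in>I. contour_integral (p k) (\<lambda>z. \<Phi> (H z)))"
    unfolding \<Phi>.sum
  proof (rule sum.cong)
    fix k assume "k \<in> I"
    then have "(\<lambda>t. cs (vector_derivative (p k) (at t within {0..1})) (H (p k t))) integrable_on {0..1}"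
      using p by (intro weakly_holomorphic_integrable[OF H V]) auto
    from integral_linear[OF this \<Phi>.bounded_linear_axioms]
    show "\<Phi> (integral {0..1} (\<lambda>t. cs (vector_derivative (p k) (at t within {0..1})) (H (p k t))))
      = contour_integral (p k) (\<lambda>z. \<Phi> (H z))"
      using \<Phi> by (simp add: contour_integral_within o_def clinear_functional_def mult.commute)
  qed simp
  also have "\<dots> = 0"
    using H \<Phi> p zero by (intro Cauchy_theorem_cycle[OF I V]) (auto simp: weakly_holomorphic_def)
  finally show "\<Phi> (\<Sum>k\<in>I. integral {0..1} (\<lambda>t. cs (vector_derivative (p k) (at t within {0..1})) (H (p k t))))
      = \<Phi> 0" by (simp add: \<Phi>.zero)
qed

end

section \<open>Quaternionic scalars and operators\<close>

lemma qRe_imag_sphere: "i \<in> imag_sphere \<Longrightarrow> qRe i = 0"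
  and norm_imag_sphere: "i \<in> imag_sphere \<Longrightarrow> norm i = 1"
  and imag_sphere_square: "i \<in> imag_sphere \<Longrightarrow> i * i = -1"
proof -
  assume i: "i \<in> imag_sphere"
  then show sq: "i * i = -1" by (simp add: imag_sphere_def power2_eq_square)
  then have "(norm i)\<^sup>2 = 1" by (metis norm_minus_cancel norm_mult norm_one power2_eq_square)
  then show "norm i = 1" by (simp add: power2_eq_1_iff) (smt (verit) norm_ge_zero)
  show "qRe i = 0"
  proof (rule ccontr)
    assume "qRe i \<noteq> 0"
    \<comment> \<open>The imaginary coordinates of the square are twice the real part times those of
      \<open>i\<close>. A nonzero real part would make \<open>i\<close> real, with square
      -1.\<close>
    then have "qIm1 i = 0" "qIm2 i = 0" "qIm3 i = 0" "qRe i * qRe i = -1"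
      using sq by (auto simp: times_quat_def one_quat_def quat_eq_iff)
    then show False by (smt (verit) zero_le_square)
  qed
qed

lemma minus_imag_sphere: "- j \<in> imag_sphere \<longleftrightarrow> j \<in> imag_sphere"
  by (simp add: imag_sphere_def)

lemma slice_emb_eq: "slice_emb j z = Re z *\<^sub>R 1 + Im z *\<^sub>R j"
  by (simp add: slice_emb_def of_real_def)

lemma bounded_linear_slice_emb: "bounded_linear (slice_emb j)"
  unfolding slice_emb_eq[abs_def]
  by (intro bounded_linear_add bounded_linear_compose[OF bounded_linear_scaleR_left]
      bounded_linear_Re bounded_linear_Im)

lemma slice_emb_mult:
  assumes "i \<in> imag_sphere"
  shows "slice_emb i (z * w) = slice_emb i z * slice_emb i w"
  using imag_sphere_square[OF assms]
  by (simp add: slice_emb_eq algebra_simps)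

lemma slice_emb_simps [simp]: "slice_emb j 1 = 1" "slice_emb j \<i> = j" "slice_emb j (of_real r) = of_real r"
  by (simp_all add: slice_emb_eq of_real_def)

lemma qRe_slice_emb: "i \<in> imag_sphere \<Longrightarrow> qRe (slice_emb i z) = Re z"
  by (simp add: slice_emb_eq qRe_imag_sphere one_quat_def)

lemma norm_slice_emb:
  assumes "i \<in> imag_sphere"
  shows "norm (slice_emb i z) = cmod z"
proof -
  have "(qIm1 i)\<^sup>2 + (qIm2 i)\<^sup>2 + (qIm3 i)\<^sup>2 = 1"
    using norm_imag_sphere[OF assms] by (simp add: norm_quat_def qRe_imag_sphere[OF assms])
  then have "(Re z)\<^sup>2 + ((Im z * qIm1 i)\<^sup>2 + (Im z * qIm2 i)\<^sup>2 + (Im z * qIm3 i)\<^sup>2) = (Re z)\<^sup>2 + (Im z)\<^sup>2"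
    by (simp add: power_mult_distrib flip: distrib_left)
  then show ?thesis
    by (simp add: norm_quat_def cmod_def slice_emb_eq qRe_imag_sphere[OF assms] one_quat_def add.assoc)
qed

lemma qcnj_slice_emb: "i \<in> imag_sphere \<Longrightarrow> qcnj (slice_emb i z) = slice_emb i (cnj z)"
  by (simp add: quat_eq_iff qcnj_def slice_emb_eq qRe_imag_sphere one_quat_def)

section \<open>Left and right scalar multiplication as operators, and inversion of operators\<close>

lemma bounded_linear_lmul_op: "bounded_linear (lmul_op :: quat \<Rightarrow> 'a::quat_banach \<Rightarrow>\<^sub>L 'a)"
proof (rule bounded_linear_intro[where K = 1])
  fix p q :: quat and r :: real
  show "lmul_op (p + q) = (lmul_op p + lmul_op q :: 'a \<Rightarrow>\<^sub>L 'a)"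
    by (rule blinfun_eqI) (simp add: lmul_op.rep_eq blinfun.add_left lscale_add_scalar)
  show "lmul_op (r *\<^sub>R q) = (r *\<^sub>R lmul_op q :: 'a \<Rightarrow>\<^sub>L 'a)"
    by (rule blinfun_eqI)
      (simp add: lmul_op.rep_eq blinfun.scaleR_left scaleR_conv_of_real lscale_of_real
        flip: lscale_lscale)
  show "norm (lmul_op q :: 'a \<Rightarrow>\<^sub>L 'a) \<le> norm q * 1"
    by (rule norm_blinfun_bound) (simp_all add: lmul_op.rep_eq norm_lscale)
qed

lemma norm_rmul_op_le: "norm (rmul_op q :: 'a::quat_banach \<Rightarrow>\<^sub>L 'a) \<le> norm q"
  by (rule norm_blinfun_bound) (simp_all add: rmul_op.rep_eq norm_rscale)

lemma bounded_linear_rmul_op: "bounded_linear (rmul_op :: quat \<Rightarrow> 'a::quat_banach \<Rightarrow>\<^sub>L 'a)"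
proof (rule bounded_linear_intro[where K = 1])
  fix p q :: quat and r :: real
  show "rmul_op (p + q) = (rmul_op p + rmul_op q :: 'a \<Rightarrow>\<^sub>L 'a)"
    by (rule blinfun_eqI) (simp add: rmul_op.rep_eq blinfun.add_left rscale_add_scalar)
  have "r *\<^sub>R q = q * of_real r" by (simp add: of_real_def)
  then show "rmul_op (r *\<^sub>R q) = (r *\<^sub>R rmul_op q :: 'a \<Rightarrow>\<^sub>L 'a)"
    by (intro blinfun_eqI)
      (simp add: rmul_op.rep_eq blinfun.scaleR_left rscale_of_real flip: rscale_rscale)
  show "norm (rmul_op q :: 'a \<Rightarrow>\<^sub>L 'a) \<le> norm q * 1" using norm_rmul_op_le by simp
qed

lemma lmul_op_compose: "lmul_op p o\<^sub>L lmul_op q = lmul_op (p * q)"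
  by (rule blinfun_eqI) (simp add: lmul_op.rep_eq lscale_lscale)

lemma rmul_op_compose: "rmul_op p o\<^sub>L rmul_op q = rmul_op (q * p)"
  by (rule blinfun_eqI) (simp add: rmul_op.rep_eq rscale_rscale)

lemma lmul_op_of_real: "lmul_op (of_real r) = r *\<^sub>R id_blinfun"
  by (rule blinfun_eqI) (simp add: lmul_op.rep_eq lscale_of_real blinfun.scaleR_left)

lemma rmul_op_of_real: "rmul_op (of_real r) = r *\<^sub>R id_blinfun"
  by (rule blinfun_eqI) (simp add: rmul_op.rep_eq rscale_of_real blinfun.scaleR_left)

lemma right_linear_commute: "right_linear A \<Longrightarrow> rmul_op q o\<^sub>L A = A o\<^sub>L rmul_op q"
  by (rule blinfun_eqI) (simp add: rmul_op.rep_eq right_linear_def)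

lemma blinfun_compose_assoc: "A o\<^sub>L B o\<^sub>L C = A o\<^sub>L (B o\<^sub>L C)"
  by (rule blinfun_eqI) simp

lemma blinfun_compose_id [simp]: "A o\<^sub>L id_blinfun = A" "id_blinfun o\<^sub>L A = A"
  by (rule blinfun_eqI, simp)+

lemmas blinfun_compose_linear =
  bounded_bilinear.add_left[OF bounded_bilinear_blinfun_compose]
  bounded_bilinear.add_right[OF bounded_bilinear_blinfun_compose]
  bounded_bilinear.diff_left[OF bounded_bilinear_blinfun_compose]
  bounded_bilinear.diff_right[OF bounded_bilinear_blinfun_compose]
  bounded_bilinear.minus_left[OF bounded_bilinear_blinfun_compose]
  bounded_bilinear.minus_right[OF bounded_bilinear_blinfun_compose]
  bounded_bilinear.scaleR_left[OF bounded_bilinear_blinfun_compose]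
  bounded_bilinear.scaleR_right[OF bounded_bilinear_blinfun_compose]

lemma op_inv_eqI:
  assumes "A o\<^sub>L B = id_blinfun" "B o\<^sub>L A = id_blinfun"
  shows "op_inv A = B"
  unfolding op_inv_def
proof (rule the_equality)
  fix C assume "A o\<^sub>L C = id_blinfun \<and> C o\<^sub>L A = id_blinfun"
  then show "C = B" by (metis assms(1) blinfun_compose_assoc blinfun_compose_id)
qed (use assms in simp)

lemma right_linear_inverse:
  assumes "right_linear A" "A o\<^sub>L B = id_blinfun" "B o\<^sub>L A = id_blinfun"
  shows "right_linear B"
  unfolding right_linear_def
proof (intro allI)
  fix x q
  have AB: "A (B y) = y" "B (A y) = y" for y
    using assms(2,3) by (metis blinfun_apply_blinfun_compose blinfun_apply_id_blinfun)+
  have "B (rscale x q) = B (rscale (A (B x)) q)" by (simp add: AB)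
  also have "\<dots> = B (A (rscale (B x) q))" using assms(1) by (simp add: right_linear_def)
  finally show "B (rscale x q) = rscale (B x) q" by (simp add: AB)
qed

text \<open>A right and a left inverse are the fixed points of the contractions X to I - K X and Y
  to I - Y K; by associativity they coincide.\<close>

lemma id_plus_contraction_invertible:
  fixes K :: "'a::banach \<Rightarrow>\<^sub>L 'a"
  assumes "norm K < 1"
  obtains X where "(id_blinfun + K) o\<^sub>L X = id_blinfun" "X o\<^sub>L (id_blinfun + K) = id_blinfun"
proof -
  have "dist (id_blinfun - (K o\<^sub>L X)) (id_blinfun - (K o\<^sub>L Y)) \<le> norm K * dist X Y" for X Y
    using norm_blinfun_compose[of K "Y - X"]
    by (simp add: dist_norm norm_minus_commute[of X] blinfun_compose_linear)
  then have "\<exists>!X. id_blinfun - (K o\<^sub>L X) = X"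
    using assms by (intro banach_fix_type[where c = "norm K"]) auto
  then obtain X where X: "id_blinfun - (K o\<^sub>L X) = X" by blast
  have "dist (id_blinfun - (X o\<^sub>L K)) (id_blinfun - (Y o\<^sub>L K)) \<le> norm K * dist X Y" for X Y
    using norm_blinfun_compose[of "Y - X" K]
    by (simp add: dist_norm norm_minus_commute[of X] blinfun_compose_linear mult.commute)
  then have "\<exists>!Y. id_blinfun - (Y o\<^sub>L K) = Y"
    using assms by (intro banach_fix_type[where c = "norm K"]) auto
  then obtain Y where Y: "id_blinfun - (Y o\<^sub>L K) = Y" by blast
  have 1: "(id_blinfun + K) o\<^sub>L X = id_blinfun"
    using X by (simp add: blinfun_compose_linear diff_eq_eq)
  have 2: "Y o\<^sub>L (id_blinfun + K) = id_blinfun"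
    using Y by (simp add: blinfun_compose_linear diff_eq_eq)
  have "X = Y" by (metis 1 2 blinfun_compose_assoc blinfun_compose_id)
  with 1 2 show thesis using that by blast
qed

text \<open>The factorization E = A (I + B (E - A)) reduces the claim to a small perturbation of the
  identity.\<close>

lemma invertible_perturbation:
  fixes A B E :: "'a::banach \<Rightarrow>\<^sub>L 'a"
  assumes AB: "A o\<^sub>L B = id_blinfun" "B o\<^sub>L A = id_blinfun" and small: "norm (E - A) * norm B < 1"
  obtains C where "E o\<^sub>L C = id_blinfun" "C o\<^sub>L E = id_blinfun"
proof -
  let ?K = "B o\<^sub>L (E - A)"
  have "norm ?K < 1"
    using norm_blinfun_compose[of B "E - A"] small by (simp add: mult.commute)
  then obtain X where X: "(id_blinfun + ?K) o\<^sub>L X = id_blinfun" "X o\<^sub>L (id_blinfun + ?K) = id_blinfun"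
    using id_plus_contraction_invertible by blast
  have "A o\<^sub>L ?K = E - A" by (simp add: AB blinfun_compose_assoc[symmetric])
  then have E: "E = A o\<^sub>L (id_blinfun + ?K)" by (simp add: blinfun_compose_linear)
  have "E o\<^sub>L (X o\<^sub>L B) = A o\<^sub>L (((id_blinfun + ?K) o\<^sub>L X) o\<^sub>L B)"
    by (subst E) (simp only: blinfun_compose_assoc)
  moreover have "(X o\<^sub>L B) o\<^sub>L E = X o\<^sub>L ((B o\<^sub>L A) o\<^sub>L (id_blinfun + ?K))"
    by (subst E) (simp only: blinfun_compose_assoc)
  ultimately show thesis using X AB by (intro that[of "X o\<^sub>L B"]) simp_all
qed

section \<open>The resolvent on a slice\<close>

locale slice_operator =
  fixes T :: "'a::quat_banach \<Rightarrow>\<^sub>L 'a" and i :: quat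
  assumes T: "right_linear T" and i: "i \<in> imag_sphere"
begin

definition resolvent_part :: "complex set" where
  "resolvent_part = slice_part (S_resolvent_set T) i"

definition Q :: "complex \<Rightarrow> 'a \<Rightarrow>\<^sub>L 'a" where
  "Q z = (T o\<^sub>L T) - (2 * Re z) *\<^sub>R T + (cmod z)\<^sup>2 *\<^sub>R id_blinfun"

definition Qinv :: "complex \<Rightarrow> 'a \<Rightarrow>\<^sub>L 'a" where
  "Qinv z = op_inv (Q z)"

definition cmul :: "complex \<Rightarrow> ('a \<Rightarrow>\<^sub>L 'a) \<Rightarrow> 'a \<Rightarrow>\<^sub>L 'a" where
  "cmul a A = rmul_op (slice_emb i a) o\<^sub>L A"

definition resolvent :: "complex \<Rightarrow> 'a \<Rightarrow>\<^sub>L 'a" where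
  "resolvent z = cmul (cnj z) (Qinv z) - (T o\<^sub>L Qinv z)"

lemma Q_op_slice_emb: "Q_op (slice_emb i z) T = Q z"
  by (simp add: Q_op_def Q_def qRe_slice_emb[OF i] norm_slice_emb[OF i])

lemma Q_cnj: "Q (cnj z) = Q z" and Qinv_cnj: "Qinv (cnj z) = Qinv z"
  by (simp_all add: Q_def Qinv_def)

lemma right_linear_Q: "right_linear (Q z)"
  using T blinfun.diff_right[of "rmul_op q :: 'a \<Rightarrow>\<^sub>L 'a" for q, unfolded rmul_op.rep_eq]
    blinfun.scaleR_right[of "rmul_op q :: 'a \<Rightarrow>\<^sub>L 'a" for q, unfolded rmul_op.rep_eq]
  by (simp add: right_linear_def Q_def blinfun.bilinear_simps rscale_add_vec)

lemma resolvent_part_iff: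
  "z \<in> resolvent_part \<longleftrightarrow> (\<exists>B. Q z o\<^sub>L B = id_blinfun \<and> B o\<^sub>L Q z = id_blinfun)"
  using right_linear_inverse[OF right_linear_Q]
  by (auto simp: resolvent_part_def slice_part_def S_resolvent_set_def Q_op_slice_emb)

lemma cnj_resolvent_part: "cnj z \<in> resolvent_part \<longleftrightarrow> z \<in> resolvent_part"
  by (simp add: resolvent_part_iff Q_cnj)

lemma Qinv:
  assumes "z \<in> resolvent_part"
  shows "Q z o\<^sub>L Qinv z = id_blinfun" "Qinv z o\<^sub>L Q z = id_blinfun" "right_linear (Qinv z)"
    "Qinv z o\<^sub>L T = T o\<^sub>L Qinv z"
proof -
  show 1: "Q z o\<^sub>L Qinv z = id_blinfun" and 2: "Qinv z o\<^sub>L Q z = id_blinfun"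
    using assms op_inv_eqI unfolding resolvent_part_iff Qinv_def by metis+
  show "right_linear (Qinv z)" using right_linear_inverse[OF right_linear_Q 1 2] .
  have "Q z o\<^sub>L T = T o\<^sub>L Q z"
    by (simp add: Q_def blinfun_compose_linear blinfun_compose_assoc)
  \<comment> \<open>As a real polynomial in \<open>T\<close>, \<open>Q z\<close> commutes with
    \<open>T\<close>; multiplying by the inverse on both sides carries this over to
    \<open>Qinv z\<close>.\<close>
  then have "Qinv z o\<^sub>L (T o\<^sub>L Q z) o\<^sub>L Qinv z = (Qinv z o\<^sub>L Q z) o\<^sub>L (T o\<^sub>L Qinv z)"
    by (simp only: blinfun_compose_assoc) (simp only: blinfun_compose_assoc[symmetric])
  then show "Qinv z o\<^sub>L T = T o\<^sub>L Qinv z"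
    by (simp add: 1 2 blinfun_compose_assoc)
qed

lemma open_resolvent_part: "open resolvent_part"
  unfolding open_contains_ball
proof
  fix z assume z: "z \<in> resolvent_part"
  have "((\<lambda>w. norm (Q w - Q z) * norm (Qinv z)) \<longlongrightarrow> 0) (at z)"
    unfolding Q_def by (auto intro!: tendsto_eq_intros)
  then have "\<forall>\<^sub>F w in at z. norm (Q w - Q z) * norm (Qinv z) < 1"
    by (rule order_tendstoD) simp
  then obtain d where d: "d > 0"
    and near: "\<And>w. w \<noteq> z \<Longrightarrow> dist w z < d \<Longrightarrow> norm (Q w - Q z) * norm (Qinv z) < 1"
    unfolding eventually_at by blast
  have "ball z d \<subseteq> resolvent_part"
  proof
    fix w assume w: "w \<in> ball z d"
    show "w \<in> resolvent_part"
    proof (cases "w = z")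
      case False
      then have "norm (Q w - Q z) * norm (Qinv z) < 1" using near w by (simp add: dist_commute)
      from invertible_perturbation[OF Qinv(1,2)[OF z] this] show ?thesis
        unfolding resolvent_part_iff by metis
    qed (use z in simp)
  qed
  with d show "\<exists>e>0. ball z e \<subseteq> resolvent_part" by blast
qed

sublocale complex_action cmul
proof
  interpret b: bounded_bilinear "\<lambda>a A. rmul_op (slice_emb i a) o\<^sub>L A :: 'a \<Rightarrow>\<^sub>L 'a"
    by (rule bounded_bilinear.comp1[OF bounded_bilinear_blinfun_compose])
      (rule bounded_linear_compose[OF bounded_linear_rmul_op bounded_linear_slice_emb])
  show "cmul (a + a') A = cmul a A + cmul a' A" "cmul a (A + A') = cmul a A + cmul a A'"
    "cmul (r *\<^sub>R a) A = r *\<^sub>R cmul a A" "cmul a (r *\<^sub>R A) = r *\<^sub>R cmul a A"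
    "\<exists>K. \<forall>a A. norm (cmul a A) \<le> norm a * norm A * K" for a a' r A A'
    unfolding cmul_def using b.bounded by (simp_all add: b.add_left b.add_right b.scaleR_left b.scaleR_right)
  have "rmul_op 1 = (id_blinfun :: 'a \<Rightarrow>\<^sub>L 'a)" using rmul_op_of_real[of 1] by simp
  then show "cmul 1 A = A" for A by (simp add: cmul_def)
  \<comment> \<open>Right multiplications compose in reversed order; commutativity of the complex
    scalars restores it.\<close>
  show "cmul (a * b) A = cmul a (cmul b A)" for a b A
    by (simp add: cmul_def blinfun_compose_assoc[symmetric] rmul_op_compose mult.commute[of a]
        slice_emb_mult[OF i])
qed

lemma cmul_of_real: "cmul (of_real r) A = r *\<^sub>R A"
  by (subst cs_eq) simp

lemma norm_cmul_le: "norm (cmul a A) \<le> cmod a * norm A"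
proof -
  have "norm (cmul a A) \<le> norm (rmul_op (slice_emb i a) :: 'a \<Rightarrow>\<^sub>L 'a) * norm A"
    unfolding cmul_def by (rule norm_blinfun_compose)
  also have "\<dots> \<le> cmod a * norm A"
    using norm_rmul_op_le[of "slice_emb i a"] by (intro mult_right_mono) (simp_all add: norm_slice_emb[OF i])
  finally show ?thesis .
qed

lemma cmul_compose: "cmul a A o\<^sub>L B = cmul a (A o\<^sub>L B)"
  by (simp add: cmul_def blinfun_compose_assoc)

lemma right_linear_cmul: "right_linear A \<Longrightarrow> A o\<^sub>L cmul a B = cmul a (A o\<^sub>L B)"
  by (simp add: cmul_def right_linear_commute blinfun_compose_assoc[symmetric])

lemma Delta_slice_emb: "Delta (slice_emb i z) T = cmul z id_blinfun - T"
  by (simp add: Delta_def cmul_def)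

text \<open>\<open>T\<close> is right linear and so commutes with the action of complex scalars. The
  product expands as a quadratic in \<open>T\<close> whose coefficients z + cnj z and z cnj z are
  real.\<close>

lemma factor_Q:
  "(cmul z id_blinfun - T) o\<^sub>L (cmul (cnj z) id_blinfun - T) = Q z"
proof -
  have "z * cnj z = of_real ((cmod z)\<^sup>2)" "z + cnj z = of_real (2 * Re z)"
    by (rule complex_norm_square[symmetric], rule complex_add_cnj)
  then have *: "cmul z (cmul (cnj z) A) = (cmod z)\<^sup>2 *\<^sub>R A" "cmul z A + cmul (cnj z) A = (2 * Re z) *\<^sub>R A" for A
    unfolding cs_mult[symmetric] add_left[symmetric] by (simp_all only: cmul_of_real)
  have "(cmul z id_blinfun - T) o\<^sub>L (cmul (cnj z) id_blinfun - T)
      = cmul z (cmul (cnj z) id_blinfun) - (cmul z T + cmul (cnj z) T) + (T o\<^sub>L T)"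
    by (simp add: blinfun_compose_linear cmul_compose right_linear_cmul[OF T])
  then show ?thesis by (simp add: * Q_def)
qed

text \<open>Since \<open>Qinv z\<close> is right linear and commutes with \<open>T\<close>, the
  conjugate factor may be written on either side of it; the factorization of \<open>Q\<close> then
  gives one inverse identity for each side.\<close>

lemma resolvent_inverse:
  assumes z: "z \<in> resolvent_part"
  shows "(cmul z id_blinfun - T) o\<^sub>L resolvent z = id_blinfun"
    "resolvent z o\<^sub>L (cmul z id_blinfun - T) = id_blinfun"
    "op_inv (Delta (slice_emb i z) T) = resolvent z"
proof -
  have l: "resolvent z = (cmul (cnj z) id_blinfun - T) o\<^sub>L Qinv z"
    by (simp add: resolvent_def blinfun_compose_linear cmul_compose)
  have r: "resolvent z = Qinv z o\<^sub>L (cmul (cnj z) id_blinfun - T)"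
    by (simp add: resolvent_def blinfun_compose_linear right_linear_cmul Qinv[OF z])
  show 1: "(cmul z id_blinfun - T) o\<^sub>L resolvent z = id_blinfun"
    by (simp add: l blinfun_compose_assoc[symmetric] factor_Q Qinv[OF z])
  show 2: "resolvent z o\<^sub>L (cmul z id_blinfun - T) = id_blinfun"
    using factor_Q[of "cnj z"] by (simp add: r blinfun_compose_assoc Q_cnj Qinv[OF z])
  show "op_inv (Delta (slice_emb i z) T) = resolvent z"
    unfolding Delta_slice_emb by (rule op_inv_eqI[OF 1 2])
qed

text \<open>The usual sandwich of the difference of the two operators between their inverses.
  \<open>resolvent w\<close> need not be right linear, but it commutes with complex scalars because
  these commute with \<open>cnj w\<close>.\<close>

lemma resolvent_identity:
  assumes z: "z \<in> resolvent_part" and w: "w \<in> resolvent_part"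
  shows "resolvent w - resolvent z = cmul (z - w) (resolvent w o\<^sub>L resolvent z)"
proof -
  have "R o\<^sub>L (A - B) o\<^sub>L S = (R o\<^sub>L (A o\<^sub>L S)) - ((R o\<^sub>L B) o\<^sub>L S)" for R S A B :: "'a \<Rightarrow>\<^sub>L 'a"
    by (simp add: blinfun_compose_linear blinfun_compose_assoc)
  from this[of "resolvent w" "cmul z id_blinfun - T" "cmul w id_blinfun - T" "resolvent z"]
  have "resolvent w o\<^sub>L (cmul (z - w) id_blinfun) o\<^sub>L resolvent z = resolvent w - resolvent z"
    by (simp add: resolvent_inverse(1)[OF z] resolvent_inverse(2)[OF w] diff_left)
  moreover have "resolvent w o\<^sub>L cmul a B = cmul a (resolvent w o\<^sub>L B)" for a B
  proof -
    have "resolvent w o\<^sub>L cmul a B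
        = cmul (cnj w) (cmul a (Qinv w o\<^sub>L B)) - cmul a (T o\<^sub>L (Qinv w o\<^sub>L B))"
      by (simp add: resolvent_def blinfun_compose_linear cmul_compose blinfun_compose_assoc
          right_linear_cmul[OF Qinv(3)[OF w]] right_linear_cmul[OF T])
    also have "\<dots> = cmul a (resolvent w o\<^sub>L B)"
      by (simp add: resolvent_def blinfun_compose_linear cmul_compose blinfun_compose_assoc diff_right
          mult.commute flip: cs_mult)
    finally show ?thesis .
  qed
  ultimately show ?thesis
    by (simp add: blinfun_compose_assoc cmul_compose)
qed

text \<open>A bootstrap: the resolvent identity bounds the difference by |w - z| C times the norm of
  \<open>resolvent w\<close>. Once |w - z| C is at most 1/2, that norm is at most 2 C, and the
  estimate becomes Lipschitz at z with constant 2 C squared.\<close>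

lemma isCont_resolvent:
  assumes z: "z \<in> resolvent_part"
  shows "isCont resolvent z"
proof -
  let ?C = "norm (resolvent z)"
  obtain r where r: "r > 0" "ball z r \<subseteq> resolvent_part"
    using open_resolvent_part z open_contains_ball by blast
  have bound: "norm (resolvent w - resolvent z) \<le> 2 * ?C\<^sup>2 * cmod (w - z)"
    if "w \<in> ball z r" "cmod (w - z) * ?C \<le> 1 / 2" for w
  proof -
    have "norm (resolvent w - resolvent z) \<le> cmod (z - w) * norm (resolvent w o\<^sub>L resolvent z)"
      using resolvent_identity[OF z, of w] that r norm_cmul_le by auto
    also have "\<dots> \<le> cmod (w - z) * (norm (resolvent w) * ?C)"
      by (simp add: norm_minus_commute mult_left_mono norm_blinfun_compose)
    finally have 1: "norm (resolvent w - resolvent z) \<le> cmod (w - z) * ?C * norm (resolvent w)"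
      by (simp add: mult_ac)
    also have "\<dots> \<le> 1 / 2 * norm (resolvent w)"
      using that by (intro mult_right_mono) auto
    finally have "norm (resolvent w) \<le> 2 * ?C"
      using norm_triangle_ineq2[of "resolvent w" "resolvent z"] by simp
    then have "cmod (w - z) * ?C * norm (resolvent w) \<le> cmod (w - z) * ?C * (2 * ?C)"
      by (intro mult_left_mono) auto
    with 1 show ?thesis by (simp add: power2_eq_square mult_ac)
  qed
  have "((\<lambda>w. cmod (w - z) * ?C) \<longlongrightarrow> 0) (at z)" "((\<lambda>w. 2 * ?C\<^sup>2 * cmod (w - z)) \<longlongrightarrow> 0) (at z)"
    by (auto intro!: tendsto_eq_intros)
  then have small: "\<forall>\<^sub>F w in at z. cmod (w - z) * ?C < 1 / 2"
    by (intro order_tendstoD(2)[where y = 0]) auto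
  have "\<forall>\<^sub>F w in at z. w \<in> ball z r"
    using r by (intro eventually_at_in_open') auto
  with small have "\<forall>\<^sub>F w in at z. norm (resolvent w - resolvent z) \<le> 2 * ?C\<^sup>2 * cmod (w - z)"
    by eventually_elim (auto intro: bound)
  then have "((\<lambda>w. resolvent w - resolvent z) \<longlongrightarrow> 0) (at z)"
    by (rule Lim_null_comparison) fact
  then show ?thesis by (simp add: isCont_def LIM_zero_iff)
qed

text \<open>By the resolvent identity the difference quotient of a functional of the resolvent is
  minus the functional of the product of two resolvents, which converges by continuity.\<close>

lemma weakly_holomorphic_resolvent:
  assumes F: "F holomorphic_on V" and V: "V \<subseteq> resolvent_part"
  shows "weakly_holomorphic (\<lambda>z. cmul (F z) (resolvent z)) V"
  unfolding weakly_holomorphic_def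
proof (intro conjI allI impI)
  have "continuous_on V resolvent"
    using V by (intro continuous_at_imp_continuous_on) (auto intro: isCont_resolvent)
  then show "continuous_on V (\<lambda>z. cmul (F z) (resolvent z))"
    using holomorphic_on_imp_continuous_on[OF F] by (intro continuous_on)
  fix \<Phi> assume \<Phi>: "clinear_functional \<Phi>"
  interpret \<Phi>: bounded_linear \<Phi> using \<Phi> by (simp add: clinear_functional_def)
  have \<Phi>_cmul: "\<Phi> (cmul a A) = a * \<Phi> A" for a A using \<Phi> by (simp add: clinear_functional_def)
  have "((\<lambda>z. \<Phi> (resolvent z)) has_field_derivative - \<Phi> (resolvent z o\<^sub>L resolvent z)) (at z)"
    if z: "z \<in> resolvent_part" for z
  proof -
    have "((\<lambda>w. - \<Phi> (resolvent w o\<^sub>L resolvent z)) \<longlongrightarrow> - \<Phi> (resolvent z o\<^sub>L resolvent z)) (at z)"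
      using isCont_resolvent[OF z]
      by (intro tendsto_minus \<Phi>.tendsto bounded_bilinear.tendsto[OF bounded_bilinear_blinfun_compose])
        (auto simp: isCont_def)
    moreover have "\<forall>\<^sub>F w in at z. w \<in> resolvent_part - {z}"
      using eventually_at_in_open[OF open_resolvent_part z] .
    then have "\<forall>\<^sub>F w in at z. - \<Phi> (resolvent w o\<^sub>L resolvent z)
        = (\<Phi> (resolvent w) - \<Phi> (resolvent z)) / (w - z)"
    proof eventually_elim
      case (elim w)
      then have "\<Phi> (resolvent w) - \<Phi> (resolvent z) = (z - w) * \<Phi> (resolvent w o\<^sub>L resolvent z)"
        using resolvent_identity[OF z, of w] by (simp flip: \<Phi>.diff \<Phi>_cmul)
      then show ?case using elim by (simp add: field_simps)
    qed
    ultimately show ?thesis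
      unfolding has_field_derivative_iff by (rule Lim_transform_eventually)
  qed
  then have "(\<lambda>z. \<Phi> (resolvent z)) holomorphic_on V"
    unfolding holomorphic_on_def field_differentiable_def
    using V has_field_derivative_at_within by blast
  then show "(\<lambda>z. \<Phi> (cmul (F z) (resolvent z))) holomorphic_on V"
    unfolding \<Phi>_cmul using F by (intro holomorphic_intros)
qed

end

section \<open>Slice hyperholomorphic functions\<close>

lemma slice_emb_cnj: "slice_emb j (cnj z) = slice_emb (- j) z"
  by (simp add: slice_emb_eq)

lemma qIm_slice_emb: "i \<in> imag_sphere \<Longrightarrow> qIm (slice_emb i z) = Im z *\<^sub>R i"
  by (simp add: qIm_def slice_emb_eq quat_eq_iff qRe_imag_sphere one_quat_def)

lemma axially_symmetric_slice_emb:
  assumes U: "axially_symmetric U" and ij: "i \<in> imag_sphere" "j \<in> imag_sphere"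
    and z: "slice_emb i z \<in> U"
  shows "slice_emb j z \<in> U"
proof -
  \<comment> \<open>Elements of \<open>sphere_class\<close> are written with a nonnegative imaginary
    factor, so a negative sign is moved into the unit.\<close>
  let ?j = "if Im z \<ge> 0 then j else - j"
  have "slice_emb j z = of_real (Re z) + of_real \<bar>Im z\<bar> * ?j"
    by (simp add: slice_emb_def)
  moreover have "?j \<in> imag_sphere" using ij by (simp add: minus_imag_sphere)
  ultimately have "slice_emb j z \<in> sphere_class (slice_emb i z)"
    using ij norm_imag_sphere[of i]
    by (auto simp: sphere_class_def qRe_slice_emb qIm_slice_emb)
  then show ?thesis using U z by (auto simp: axially_symmetric_def)
qed

text \<open>Conjugation on the slice of \<open>i\<close> is the passage to the slice of
  \<open>- i\<close>, under which axial symmetry is invariant.\<close>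

lemma slice_part_cnj:
  assumes "axially_symmetric U" "i \<in> imag_sphere"
  shows "cnj z \<in> slice_part U i \<longleftrightarrow> z \<in> slice_part U i"
  using axially_symmetric_slice_emb[OF assms(1), of i "- i" z]
    axially_symmetric_slice_emb[OF assms(1), of "- i" i z] assms(2)
  by (auto simp: slice_part_def slice_emb_cnj minus_imag_sphere)

lemma slice_plane_iff:
  assumes "axially_symmetric U" "i \<in> imag_sphere"
  shows "(Re z, Im z) \<in> slice_plane U \<longleftrightarrow> z \<in> slice_part U i"
  using axially_symmetric_slice_emb[OF assms(1,2)] assms(2)
  by (auto simp: slice_plane_def slice_part_def slice_emb_def)

lemma continuous_on_slice_emb: "continuous_on S (slice_emb j)"
  by (rule linear_continuous_on[OF bounded_linear_slice_emb])

lemma slice_part_vimage: "slice_part U j = slice_emb j -` U"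
  by (auto simp: slice_part_def)

lemma open_slice_part: "open U \<Longrightarrow> open (slice_part U j)"
  unfolding slice_part_vimage by (rule open_vimage[OF _ continuous_on_slice_emb])

lemma closure_slice_part: "closure (slice_part D j) \<subseteq> slice_part (closure D) j"
proof (rule closure_minimal)
  show "slice_part D j \<subseteq> slice_part (closure D) j"
    using closure_subset by (auto simp: slice_part_def)
  show "closed (slice_part (closure D) j)"
    unfolding slice_part_vimage by (rule closed_vimage[OF closed_closure continuous_on_slice_emb])
qed

lemma partial_alpha_eq:
  assumes "(g has_derivative g') (at (\<alpha>, \<beta>))"
  shows "partial_alpha g \<alpha> \<beta> = g' (1, 0)"
proof -
  have "((\<lambda>t. (t, \<beta>)) has_vector_derivative (1, 0)) (at \<alpha>)"
    by (intro has_vector_derivative_Pair has_vector_derivative_id has_vector_derivative_const)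
  from vector_derivative_diff_chain_within[OF this has_derivative_at_withinI[OF assms]]
  have "(g \<circ> (\<lambda>t. (t, \<beta>)) has_vector_derivative g' (1, 0)) (at \<alpha>)"
    .
  then show ?thesis unfolding partial_alpha_def o_def by (rule vector_derivative_at)
qed

lemma partial_beta_eq:
  assumes "(g has_derivative g') (at (\<alpha>, \<beta>))"
  shows "partial_beta g \<alpha> \<beta> = g' (0, 1)"
proof -
  have "((\<lambda>t. (\<alpha>, t)) has_vector_derivative (0, 1)) (at \<beta>)"
    by (intro has_vector_derivative_Pair has_vector_derivative_id has_vector_derivative_const)
  from vector_derivative_diff_chain_within[OF this has_derivative_at_withinI[OF assms]]
  have "(g \<circ> (\<lambda>t. (\<alpha>, t)) has_vector_derivative g' (0, 1)) (at \<beta>)"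
    .
  then show ?thesis unfolding partial_beta_def o_def by (rule vector_derivative_at)
qed

lemma bounded_linear_qRe: "bounded_linear qRe"
  and bounded_linear_qIm1: "bounded_linear qIm1"
  and bounded_linear_qIm2: "bounded_linear qIm2"
  and bounded_linear_qIm3: "bounded_linear qIm3"
  using bounded_linear_inner_left[of "Quat 1 0 0 0"] bounded_linear_inner_left[of "Quat 0 1 0 0"]
    bounded_linear_inner_left[of "Quat 0 0 1 0"] bounded_linear_inner_left[of "Quat 0 0 0 1"]
  by (simp_all add: inner_quat_def)

text \<open>A real linear map commutes with partial derivatives and signs, so it preserves parity
  and the Cauchy--Riemann equations. With \<open>L\<close> a coordinate function this extracts the
  real components of \<open>g0\<close> and \<open>g1\<close>.\<close>

lemma slice_components_compose:
  assumes L: "bounded_linear L" and g: "slice_components U g0 g1"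
  shows "slice_components U (\<lambda>p. L (g0 p)) (\<lambda>p. L (g1 p))"
proof -
  interpret L: bounded_linear L by fact
  have C1: "C1_on W (\<lambda>p. L (g p)) \<and> (\<forall>\<alpha> \<beta>. (\<alpha>, \<beta>) \<in> W \<longrightarrow>
      partial_alpha (\<lambda>p. L (g p)) \<alpha> \<beta> = L (partial_alpha g \<alpha> \<beta>) \<and>
      partial_beta (\<lambda>p. L (g p)) \<alpha> \<beta> = L (partial_beta g \<alpha> \<beta>))" if "C1_on W g" for W g
  proof -
    obtain g' where g': "\<And>p. p \<in> W \<Longrightarrow> (g has_derivative blinfun_apply (g' p)) (at p)"
      and cont: "continuous_on W g'" using \<open>C1_on W g\<close> by (auto simp: C1_on_def)
    have D: "((\<lambda>p. L (g p)) has_derivative blinfun_apply (Blinfun L o\<^sub>L g' p)) (at p)" if "p \<in> W" for p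
    proof -
      have "blinfun_apply (Blinfun L o\<^sub>L g' p) = (\<lambda>x. L (g' p x))"
        by (rule ext) (simp add: bounded_linear_Blinfun_apply[OF L])
      then show ?thesis using L.has_derivative[OF g'[OF that]] by simp
    qed
    have "continuous_on W (\<lambda>p. Blinfun L o\<^sub>L g' p)"
      using cont
      by (intro bounded_bilinear.continuous_on[OF bounded_bilinear_blinfun_compose] continuous_on_const)
    then have "C1_on W (\<lambda>p. L (g p))"
      unfolding C1_on_def using D by (intro exI[of _ "\<lambda>p. Blinfun L o\<^sub>L g' p"] conjI ballI)
    moreover have "partial_alpha (\<lambda>p. L (g p)) \<alpha> \<beta> = L (partial_alpha g \<alpha> \<beta>)"
      "partial_beta (\<lambda>p. L (g p)) \<alpha> \<beta> = L (partial_beta g \<alpha> \<beta>)" if "(\<alpha>, \<beta>) \<in> W" for \<alpha> \<beta>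
      unfolding partial_alpha_eq[OF g'[OF that]] partial_alpha_eq[OF D[OF that]]
        partial_beta_eq[OF g'[OF that]] partial_beta_eq[OF D[OF that]]
      by (simp_all add: bounded_linear_Blinfun_apply[OF L])
    ultimately show ?thesis by blast
  qed
  have "C1_on (slice_plane U) g0" "C1_on (slice_plane U) g1"
    using g by (simp_all add: slice_components_def)
  note C1[OF this(1)] C1[OF this(2)]
  with g show ?thesis
    unfolding slice_components_def by (simp add: L.neg L.zero flip: L.diff L.add)
qed

text \<open>Reads q as its real part plus |Im q| times the unit \<open>sgn (qIm q)\<close>. For real
  q the sign is 0, so the second term drops out, consistent with an odd \<open>g1\<close>.\<close>

definition slice_fun :: "(real \<times> real \<Rightarrow> quat) \<Rightarrow> (real \<times> real \<Rightarrow> quat) \<Rightarrow> quat \<Rightarrow> quat" where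
  "slice_fun g0 g1 q = g0 (qRe q, norm (qIm q)) + sgn (qIm q) * g1 (qRe q, norm (qIm q))"

text \<open>For negative imaginary part, the parity of \<open>g0\<close> and \<open>g1\<close>
  compensates the absolute value and the flipped unit; on the real axis, oddness forces
  \<open>g1\<close> to vanish.\<close>

lemma slice_fun_slice_emb:
  assumes g: "slice_components U g0 g1" and U: "axially_symmetric U" and j: "j \<in> imag_sphere"
    and z: "z \<in> slice_part U j"
  shows "slice_fun g0 g1 (slice_emb j z) = g0 (Re z, Im z) + j * g1 (Re z, Im z)"
proof -
  have "(Re z, Im z) \<in> slice_plane U" using slice_plane_iff[OF U j] z by simp
  then have g': "g0 (Re z, - Im z) = g0 (Re z, Im z)" "g1 (Re z, - Im z) = - g1 (Re z, Im z)"
    using g by (auto simp: slice_components_def)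
  have sf: "slice_fun g0 g1 (slice_emb j z)
      = g0 (Re z, \<bar>Im z\<bar>) + sgn (Im z) *\<^sub>R j * g1 (Re z, \<bar>Im z\<bar>)"
    using norm_imag_sphere[OF j]
    by (simp add: slice_fun_def qRe_slice_emb[OF j] qIm_slice_emb[OF j] sgn_scaleR sgn_div_norm[of j])
  consider "Im z > 0" | "Im z < 0" | "Im z = 0" by linarith
  then show ?thesis
  proof cases
    case 3
    then have "2 *\<^sub>R g1 (Re z, Im z) = 0" using g'(2) by (simp add: scaleR_2 add_eq_0_iff)
    then show ?thesis using 3 by (simp add: sf)
  qed (simp_all add: sf g')
qed

lemma slice_emb_cases:
  obtains j z where "j \<in> imag_sphere" "q = slice_emb j z"
proof (cases "qIm q = 0")
  case True
  have "qi \<in> imag_sphere"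
    by (simp add: imag_sphere_def qi_def power2_eq_square times_quat_def one_quat_def uminus_quat_def)
  moreover have "q = slice_emb qi (Complex (qRe q) 0)"
    using True by (simp add: slice_emb_eq qIm_def quat_eq_iff one_quat_def)
  ultimately show thesis using that by blast
next
  case False
  let ?n = "norm (qIm q)"
  have n: "?n\<^sup>2 = (qIm1 q)\<^sup>2 + (qIm2 q)\<^sup>2 + (qIm3 q)\<^sup>2"
    by (simp add: norm_quat_def qIm_def)
  have "qIm q * qIm q = - (?n\<^sup>2 *\<^sub>R 1)"
    by (subst n) (simp add: qIm_def times_quat_def quat_eq_iff one_quat_def power2_eq_square)
  moreover have "inverse ?n * (inverse ?n * ?n\<^sup>2) = 1"
    using False by (simp add: power2_eq_square field_simps)
  ultimately have "sgn (qIm q) * sgn (qIm q) = -1"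
    by (simp add: sgn_div_norm)
  then have "sgn (qIm q) \<in> imag_sphere" by (simp add: imag_sphere_def power2_eq_square)
  moreover have "q = slice_emb (sgn (qIm q)) (Complex (qRe q) ?n)"
    using False by (simp add: slice_emb_eq sgn_div_norm) (simp add: quat_eq_iff qIm_def one_quat_def)
  ultimately show thesis using that by blast
qed

lemma intrinsic_slice_fun:
  assumes U: "open U" "axially_symmetric U" and g: "slice_components U g0 g1"
    and c: "bounded_linear c"
  shows "intrinsic_slice_hyperholomorphic U
    (slice_fun (\<lambda>p. of_real (c (g0 p))) (\<lambda>p. of_real (c (g1 p))))"
proof -
  have comp: "slice_components U (\<lambda>p. of_real (c (g0 p))) (\<lambda>p. of_real (c (g1 p)))"
    using slice_components_compose[OF bounded_linear_compose[OF bounded_linear_of_real c] g] .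
  moreover have "left_represents U (slice_fun (\<lambda>p. of_real (c (g0 p))) (\<lambda>p. of_real (c (g1 p))))
      (\<lambda>p. of_real (c (g0 p))) (\<lambda>p. of_real (c (g1 p)))"
    unfolding left_represents_def
  proof (intro allI ballI impI)
    fix \<alpha> \<beta> j assume j: "j \<in> imag_sphere" and "of_real \<alpha> + of_real \<beta> * j \<in> U"
    then have "Complex \<alpha> \<beta> \<in> slice_part U j" by (simp add: slice_part_def slice_emb_def)
    from slice_fun_slice_emb[OF comp U(2) j this]
    show "slice_fun (\<lambda>p. of_real (c (g0 p))) (\<lambda>p. of_real (c (g1 p))) (of_real \<alpha> + of_real \<beta> * j)
        = of_real (c (g0 (\<alpha>, \<beta>))) + j * of_real (c (g1 (\<alpha>, \<beta>)))"
      by (simp add: slice_emb_def)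
  qed
  ultimately show ?thesis
    unfolding intrinsic_slice_hyperholomorphic_def using U
    by (intro conjI exI ballI) (assumption | rule Reals_of_real)+
qed

lemma quat_decompose_left:
  "q = of_real (qRe q) + qi * of_real (qIm1 q) + qj * of_real (qIm2 q) + qk * of_real (qIm3 q)"
  by (simp add: quat_eq_iff qi_def qj_def qk_def times_quat_def of_real_def one_quat_def)

lemma of_real_quat_commute: "of_real r * (q::quat) = q * of_real r"
  by (simp add: of_real_def)

lemma quat_decompose_right:
  "q = of_real (qRe q) + of_real (qIm1 q) * qi + of_real (qIm2 q) * qj + of_real (qIm3 q) * qk"
  unfolding of_real_quat_commute by (rule quat_decompose_left)

text \<open>The components are expanded in real coordinates with the basis units on the left, since
  the slice unit j multiplies \<open>g1\<close> from the right and the real coefficients commute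
  with it.\<close>

lemma right_slice_hyperholomorphic_decompose:
  assumes "right_slice_hyperholomorphic U f"
  obtains f1 f2 f3 f4 where
    "intrinsic_slice_hyperholomorphic U f1" "intrinsic_slice_hyperholomorphic U f2"
    "intrinsic_slice_hyperholomorphic U f3" "intrinsic_slice_hyperholomorphic U f4"
    "\<And>q. q \<in> U \<Longrightarrow> f q = f1 q + qi * f2 q + qj * f3 q + qk * f4 q"
proof -
  obtain g0 g1 where U: "open U" "axially_symmetric U" and g: "slice_components U g0 g1"
    and rep: "right_represents U f g0 g1"
    using assms by (auto simp: right_slice_hyperholomorphic_def)
  define h where "h c = slice_fun (\<lambda>p. of_real (c (g0 p))) (\<lambda>p. of_real (c (g1 p)))" for c
  have "f q = h qRe q + qi * h qIm1 q + qj * h qIm2 q + qk * h qIm3 q" if q: "q \<in> U" for q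
  proof -
    obtain j z where j: "j \<in> imag_sphere" and z: "q = slice_emb j z" by (rule slice_emb_cases)
    let ?a = "g0 (Re z, Im z)" and ?b = "g1 (Re z, Im z)"
    have h: "h c q = of_real (c ?a) + of_real (c ?b) * j" if "bounded_linear c" for c
      unfolding h_def z of_real_quat_commute
      using q z slice_components_compose[OF bounded_linear_compose[OF bounded_linear_of_real that] g]
      by (intro slice_fun_slice_emb[OF _ U(2) j]) (auto simp: slice_part_def)
    have "f q = ?a + ?b * j"
      using rep q j unfolding z right_represents_def slice_emb_def by blast
    also have "\<dots> = (of_real (qRe ?a) + qi * of_real (qIm1 ?a) + qj * of_real (qIm2 ?a) + qk * of_real (qIm3 ?a))
        + (of_real (qRe ?b) + qi * of_real (qIm1 ?b) + qj * of_real (qIm2 ?b) + qk * of_real (qIm3 ?b)) * j"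
      by (simp only: quat_decompose_left[symmetric])
    also have "\<dots> = h qRe q + qi * h qIm1 q + qj * h qIm2 q + qk * h qIm3 q"
      by (simp add: h bounded_linear_qRe bounded_linear_qIm1 bounded_linear_qIm2 bounded_linear_qIm3
          algebra_simps)
    finally show ?thesis .
  qed
  then show thesis
    by (intro that[of "h qRe" "h qIm1" "h qIm2" "h qIm3"])
      (auto simp: h_def intro!: intrinsic_slice_fun U g
        bounded_linear_qRe bounded_linear_qIm1 bounded_linear_qIm2 bounded_linear_qIm3)
qed

text \<open>Mirror image of the right case: j stands to the left of \<open>g1\<close>, so the basis
  units go to the right.\<close>

lemma left_slice_hyperholomorphic_decompose:
  assumes "left_slice_hyperholomorphic U f"
  obtains f1 f2 f3 f4 where
    "intrinsic_slice_hyperholomorphic U f1" "intrinsic_slice_hyperholomorphic U f2"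
    "intrinsic_slice_hyperholomorphic U f3" "intrinsic_slice_hyperholomorphic U f4"
    "\<And>q. q \<in> U \<Longrightarrow> f q = f1 q + f2 q * qi + f3 q * qj + f4 q * qk"
proof -
  obtain g0 g1 where U: "open U" "axially_symmetric U" and g: "slice_components U g0 g1"
    and rep: "left_represents U f g0 g1"
    using assms by (auto simp: left_slice_hyperholomorphic_def)
  define h where "h c = slice_fun (\<lambda>p. of_real (c (g0 p))) (\<lambda>p. of_real (c (g1 p)))" for c
  have "f q = h qRe q + h qIm1 q * qi + h qIm2 q * qj + h qIm3 q * qk" if q: "q \<in> U" for q
  proof -
    obtain j z where j: "j \<in> imag_sphere" and z: "q = slice_emb j z" by (rule slice_emb_cases)
    let ?a = "g0 (Re z, Im z)" and ?b = "g1 (Re z, Im z)"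
    have h: "h c q = of_real (c ?a) + j * of_real (c ?b)" if "bounded_linear c" for c
      unfolding h_def z
      using q z slice_components_compose[OF bounded_linear_compose[OF bounded_linear_of_real that] g]
      by (intro slice_fun_slice_emb[OF _ U(2) j]) (auto simp: slice_part_def)
    have "f q = ?a + j * ?b"
      using rep q j unfolding z left_represents_def slice_emb_def by blast
    also have "\<dots> = (of_real (qRe ?a) + of_real (qIm1 ?a) * qi + of_real (qIm2 ?a) * qj + of_real (qIm3 ?a) * qk)
        + j * (of_real (qRe ?b) + of_real (qIm1 ?b) * qi + of_real (qIm2 ?b) * qj + of_real (qIm3 ?b) * qk)"
      by (simp only: quat_decompose_right[symmetric])
    also have "\<dots> = h qRe q + h qIm1 q * qi + h qIm2 q * qj + h qIm3 q * qk"
      by (simp add: h bounded_linear_qRe bounded_linear_qIm1 bounded_linear_qIm2 bounded_linear_qIm3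
          algebra_simps)
    finally show ?thesis .
  qed
  then show thesis
    by (intro that[of "h qRe" "h qIm1" "h qIm2" "h qIm3"])
      (auto simp: h_def intro!: intrinsic_slice_fun U g
        bounded_linear_qRe bounded_linear_qIm1 bounded_linear_qIm2 bounded_linear_qIm3)
qed

text \<open>With real components, g0 + i g1 stays in the slice and is an ordinary complex function;
  the conditions on the components are its Cauchy--Riemann equations and its symmetry under
  conjugation.\<close>

lemma intrinsic_slice_restriction:
  assumes "intrinsic_slice_hyperholomorphic U f" and i: "i \<in> imag_sphere"
  obtains F where "F holomorphic_on slice_part U i"
    "\<And>z. z \<in> slice_part U i \<Longrightarrow> F (cnj z) = cnj (F z)"
    "\<And>z. z \<in> slice_part U i \<Longrightarrow> f (slice_emb i z) = slice_emb i (F z)"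
proof -
  obtain g0 g1 where U: "open U" "axially_symmetric U" and g: "slice_components U g0 g1"
    and rep: "left_represents U f g0 g1" and real: "\<And>p. p \<in> slice_plane U \<Longrightarrow> g0 p \<in> \<real> \<and> g1 p \<in> \<real>"
    using assms(1) by (auto simp: intrinsic_slice_hyperholomorphic_def)
  let ?p = "\<lambda>z. (Re z, Im z)"
  define F where "F z = Complex (qRe (g0 (?p z))) (qRe (g1 (?p z)))" for z
  have plane: "?p z \<in> slice_plane U" if "z \<in> slice_part U i" for z
    using slice_plane_iff[OF U(2) i] that by simp
  have "F field_differentiable at z" if z: "z \<in> slice_part U i" for z
  proof -
    obtain D0 D1 where D: "(g0 has_derivative D0) (at (?p z))" "(g1 has_derivative D1) (at (?p z))"
      using g plane[OF z] unfolding slice_components_def C1_on_def by metis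
    have "partial_alpha g0 (Re z) (Im z) - partial_beta g1 (Re z) (Im z) = 0"
      "partial_beta g0 (Re z) (Im z) + partial_alpha g1 (Re z) (Im z) = 0"
      using g plane[OF z] unfolding slice_components_def by blast+
    then have CR: "D0 (1, 0) = D1 (0, 1)" "D0 (0, 1) = - D1 (1, 0)"
      unfolding partial_alpha_eq[OF D(1)] partial_alpha_eq[OF D(2)]
        partial_beta_eq[OF D(1)] partial_beta_eq[OF D(2)]
      by (simp_all add: eq_neg_iff_add_eq_0)
    interpret D0: bounded_linear D0 using D(1) by (rule has_derivative_bounded_linear)
    interpret D1: bounded_linear D1 using D(2) by (rule has_derivative_bounded_linear)
    \<comment> \<open>The complex derivative is the derivative in the real direction.\<close>
    let ?d = "Complex (qRe (D0 (1, 0))) (qRe (D1 (1, 0)))"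
    have split: "D0 (a, b) = a *\<^sub>R D0 (1, 0) + b *\<^sub>R D0 (0, 1)" "D1 (a, b) = a *\<^sub>R D1 (1, 0) + b *\<^sub>R D1 (0, 1)" for a b
      using D0.add[of "(a, 0)" "(0, b)"] D0.scaleR[of a "(1, 0)"] D0.scaleR[of b "(0, 1)"]
        D1.add[of "(a, 0)" "(0, b)"] D1.scaleR[of a "(1, 0)"] D1.scaleR[of b "(0, 1)"]
      by simp_all
    have p: "(?p has_derivative ?p) (at z)"
      by (intro bounded_linear_imp_has_derivative bounded_linear_Pair bounded_linear_Re bounded_linear_Im)
    have "((\<lambda>z. of_real (qRe (g0 (?p z))) + \<i> * of_real (qRe (g1 (?p z)))) has_derivative
      (\<lambda>h. of_real (qRe (D0 (?p h))) + \<i> * of_real (qRe (D1 (?p h))))) (at z)"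
      using has_derivative_compose[OF p D(1)] has_derivative_compose[OF p D(2)]
      by (intro has_derivative_add has_derivative_mult_right has_derivative_of_real
          bounded_linear.has_derivative[OF bounded_linear_qRe])
    moreover have "(\<lambda>h. of_real (qRe (D0 (?p h))) + \<i> * of_real (qRe (D1 (?p h)))) = (*) ?d"
    proof (rule ext)
      fix h :: complex
      show "of_real (qRe (D0 (?p h))) + \<i> * of_real (qRe (D1 (?p h))) = ?d * h"
        unfolding split[of "Re h" "Im h"] CR(2) by (simp add: complex_eq_iff CR(1) algebra_simps)
    qed
    moreover have "(\<lambda>z. of_real (qRe (g0 (?p z))) + \<i> * of_real (qRe (g1 (?p z)))) = F"
      by (rule ext) (simp add: complex_eq_iff F_def)
    ultimately have "(F has_field_derivative ?d) (at z)" by (simp add: has_field_derivative_def)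
    then show ?thesis by (auto simp: field_differentiable_def)
  qed
  then have "F holomorphic_on slice_part U i"
    by (simp add: holomorphic_on_def field_differentiable_at_within)
  moreover have "F (cnj z) = cnj (F z)" if "z \<in> slice_part U i" for z
    using g plane[OF that] by (auto simp: slice_components_def F_def complex_eq_iff)
  moreover have "f (slice_emb i z) = slice_emb i (F z)" if z: "z \<in> slice_part U i" for z
  proof -
    have "of_real (qRe q) = q" if "q \<in> \<real>" for q :: quat
      using that by (auto elim!: Reals_cases simp: of_real_def one_quat_def)
    then have "g0 (?p z) = of_real (Re (F z))" "g1 (?p z) = of_real (Im (F z))"
      using real[OF plane[OF z]] by (simp_all add: F_def)
    moreover have "f (slice_emb i z) = g0 (?p z) + i * g1 (?p z)"
      using rep i z by (simp add: left_represents_def slice_emb_def slice_part_def)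
    ultimately show ?thesis by (simp add: slice_emb_def of_real_quat_commute)
  qed
  ultimately show thesis by (rule that)
qed

section \<open>Integrals over the boundary cycle\<close>

text \<open>\<open>cycle_integral\<close> is total, so integrability has to be carried along for
  linearity to hold.\<close>

definition cycle_integrable ::
  "(real \<Rightarrow> complex) set \<Rightarrow> (complex \<Rightarrow> complex \<Rightarrow> 'b::real_normed_vector) \<Rightarrow> bool" where
  "cycle_integrable \<Gamma> h \<longleftrightarrow>
     (\<forall>\<gamma>\<in>\<Gamma>. (\<lambda>t. h (\<gamma> t) (vector_derivative \<gamma> (at t within {0..1}))) integrable_on {0..1})"

lemma cycle_integral_add:
  assumes "cycle_integrable \<Gamma> h" "cycle_integrable \<Gamma> k"
  shows "cycle_integrable \<Gamma> (\<lambda>z dz. h z dz + k z dz)"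
    "cycle_integral \<Gamma> (\<lambda>z dz. h z dz + k z dz) = cycle_integral \<Gamma> h + cycle_integral \<Gamma> k"
  using assms
  by (auto simp: cycle_integrable_def cycle_integral_def integral_add integrable_add
      sum.distrib[symmetric] intro!: sum.cong)

lemma cycle_integral_linear:
  assumes "cycle_integrable \<Gamma> h" "bounded_linear L"
  shows "cycle_integrable \<Gamma> (\<lambda>z dz. L (h z dz))"
    "cycle_integral \<Gamma> (\<lambda>z dz. L (h z dz)) = L (cycle_integral \<Gamma> h)"
proof -
  interpret L: bounded_linear L by fact
  have "(\<lambda>t. L (h (\<gamma> t) (vector_derivative \<gamma> (at t within {0..1})))) integrable_on {0..1}"
    "integral {0..1} (\<lambda>t. L (h (\<gamma> t) (vector_derivative \<gamma> (at t within {0..1}))))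
      = L (integral {0..1} (\<lambda>t. h (\<gamma> t) (vector_derivative \<gamma> (at t within {0..1}))))"
    if "\<gamma> \<in> \<Gamma>" for \<gamma>
    using integrable_linear[OF _ assms(2)] integral_linear[OF _ assms(2)] assms(1) that
    unfolding cycle_integrable_def o_def by blast+
  then show "cycle_integrable \<Gamma> (\<lambda>z dz. L (h z dz))"
    "cycle_integral \<Gamma> (\<lambda>z dz. L (h z dz)) = L (cycle_integral \<Gamma> h)"
    by (simp_all add: cycle_integrable_def cycle_integral_def L.sum)
qed

lemma cycle_integral_cong:
  assumes "\<And>\<gamma> z dz. \<gamma> \<in> \<Gamma> \<Longrightarrow> z \<in> path_image \<gamma> \<Longrightarrow> h z dz = k z dz"
  shows "cycle_integrable \<Gamma> h \<longleftrightarrow> cycle_integrable \<Gamma> k" "cycle_integral \<Gamma> h = cycle_integral \<Gamma> k"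
proof -
  have "h (\<gamma> t) (vector_derivative \<gamma> (at t within {0..1})) = k (\<gamma> t) (vector_derivative \<gamma> (at t within {0..1}))"
    if "\<gamma> \<in> \<Gamma>" "t \<in> {0..1}" for \<gamma> t
    using assms that by (auto simp: path_image_def)
  then have "(\<lambda>t. h (\<gamma> t) (vector_derivative \<gamma> (at t within {0..1}))) integrable_on {0..1} \<longleftrightarrow>
      (\<lambda>t. k (\<gamma> t) (vector_derivative \<gamma> (at t within {0..1}))) integrable_on {0..1}"
    "integral {0..1} (\<lambda>t. h (\<gamma> t) (vector_derivative \<gamma> (at t within {0..1})))
      = integral {0..1} (\<lambda>t. k (\<gamma> t) (vector_derivative \<gamma> (at t within {0..1})))"
    if "\<gamma> \<in> \<Gamma>" for \<gamma>
    using that by (intro integrable_cong integral_cong; blast)+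
  then show "cycle_integrable \<Gamma> h \<longleftrightarrow> cycle_integrable \<Gamma> k" "cycle_integral \<Gamma> h = cycle_integral \<Gamma> k"
    by (simp_all add: cycle_integrable_def cycle_integral_def)
qed

lemma lmul_op_slice_emb:
  fixes A :: "'a::quat_banach \<Rightarrow>\<^sub>L 'a"
  shows "lmul_op (slice_emb i c) o\<^sub>L A = Re c *\<^sub>R A + Im c *\<^sub>R (lmul_op i o\<^sub>L A)"
  "A o\<^sub>L lmul_op (slice_emb i c) = Re c *\<^sub>R A + Im c *\<^sub>R (A o\<^sub>L lmul_op i)"
proof -
  interpret bounded_linear "lmul_op :: quat \<Rightarrow> 'a::quat_banach \<Rightarrow>\<^sub>L 'a"
    by (rule bounded_linear_lmul_op)
  have "lmul_op 1 = (id_blinfun :: 'a \<Rightarrow>\<^sub>L 'a)" using lmul_op_of_real[of 1] by simp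
  then have "lmul_op (slice_emb i c) = Re c *\<^sub>R id_blinfun + Im c *\<^sub>R (lmul_op i :: 'a \<Rightarrow>\<^sub>L 'a)"
    by (simp add: slice_emb_eq add scaleR)
  then show "lmul_op (slice_emb i c) o\<^sub>L A = Re c *\<^sub>R A + Im c *\<^sub>R (lmul_op i o\<^sub>L A)"
    "A o\<^sub>L lmul_op (slice_emb i c) = Re c *\<^sub>R A + Im c *\<^sub>R (A o\<^sub>L lmul_op i)"
    by (simp_all add: blinfun_compose_linear)
qed

section \<open>The boundary cycle and its complex conjugate\<close>

locale slice_calculus = slice_operator +
  fixes D U :: "quat set" and \<Gamma> :: "(real \<Rightarrow> complex) set"
  assumes D: "open D" "axially_symmetric D"
    and spectrum: "S_spectrum T \<subseteq> D"
    and boundary: "positively_oriented_boundary (slice_part D i) \<Gamma>"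
    and U: "open U" "axially_symmetric U" "closure D \<subseteq> U"
begin

definition V :: "complex set" where
  "V = slice_part U i \<inter> resolvent_part"

lemma finite_\<Gamma>: "finite \<Gamma>"
  using boundary by (simp add: positively_oriented_boundary_def bounded_by_jordan_curves_def)

lemma closure_slice_part_D: "closure (slice_part D i) \<subseteq> slice_part U i"
  using closure_slice_part[of D i] U(3) by (auto simp: slice_part_def)

lemma open_V: "open V"
  by (simp add: V_def open_Int open_slice_part[OF U(1)] open_resolvent_part)

lemma cnj_V: "cnj z \<in> V \<longleftrightarrow> z \<in> V"
  by (simp add: V_def slice_part_cnj[OF U(2) i] cnj_resolvent_part)

lemma \<Gamma>_curve:
  assumes "\<gamma> \<in> \<Gamma>"
  shows "valid_path \<gamma>" "pathfinish \<gamma> = pathstart \<gamma>" "path_image \<gamma> \<subseteq> V"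
proof -
  have "jordan_curve \<gamma>" and fr: "frontier (slice_part D i) = (\<Union>\<gamma>\<in>\<Gamma>. path_image \<gamma>)"
    using boundary assms
    by (simp_all add: positively_oriented_boundary_def bounded_by_jordan_curves_def)
  then show "valid_path \<gamma>" "pathfinish \<gamma> = pathstart \<gamma>" by (simp_all add: jordan_curve_def)
  have "path_image \<gamma> \<subseteq> frontier (slice_part D i)" using fr assms by blast
  also have "\<dots> = closure (slice_part D i) - slice_part D i"
    by (simp add: frontier_def interior_open open_slice_part[OF D(1)])
  also have "\<dots> \<subseteq> V"
    using closure_slice_part_D spectrum
    by (auto simp: V_def resolvent_part_def slice_part_def S_spectrum_def)
  finally show "path_image \<gamma> \<subseteq> V" .
qed

text \<open>A point outside \<open>V\<close> is either spectral, hence in the slice of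
  \<open>D\<close>, where the totals are 1 and -1, or outside the slice of \<open>U\<close>, hence
  off the closure, where both are 0. Each alternative is stable under conjugation.\<close>

lemma winding_number_cancel:
  assumes w: "w \<notin> V"
  shows "(\<Sum>\<gamma>\<in>\<Gamma>. winding_number \<gamma> w) + (\<Sum>\<gamma>\<in>\<Gamma>. winding_number (cnj \<circ> \<gamma>) w) = 0"
proof -
  have "winding_number (cnj \<circ> \<gamma>) w = - cnj (winding_number \<gamma> (cnj w))" if "\<gamma> \<in> \<Gamma>" for \<gamma>
    using winding_number_cnj[of \<gamma> "cnj w"] \<Gamma>_curve[OF that] cnj_V[of w] w
    by (auto simp: valid_path_imp_path)
  then have conj: "(\<Sum>\<gamma>\<in>\<Gamma>. winding_number (cnj \<circ> \<gamma>) w) = - cnj (\<Sum>\<gamma>\<in>\<Gamma>. winding_number \<gamma> (cnj w))"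
    by (simp add: sum_negf)
  show ?thesis
  proof (cases "w \<in> slice_part U i")
    case True
    then have "slice_emb i w \<in> S_spectrum T"
      using w by (auto simp: V_def resolvent_part_def slice_part_def S_spectrum_def)
    then have "w \<in> slice_part D i" using spectrum by (auto simp: slice_part_def)
    moreover from this have "cnj w \<in> slice_part D i" by (simp only: slice_part_cnj[OF D(2) i])
    ultimately show ?thesis using boundary by (simp add: conj positively_oriented_boundary_def)
  next
    case False
    then have "w \<notin> closure (slice_part D i)" "cnj w \<notin> closure (slice_part D i)"
      using closure_slice_part_D slice_part_cnj[OF U(2) i, of w] by auto
    then show ?thesis using boundary by (simp add: conj positively_oriented_boundary_def)
  qed
qed

lemma vector_derivative_cnj_path:
  assumes "valid_path \<gamma>"
  obtains S where "finite S" "\<And>t. t \<in> {0..1} - S \<Longrightarrow>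
    vector_derivative (cnj \<circ> \<gamma>) (at t within {0..1}) = cnj (vector_derivative \<gamma> (at t within {0..1}))"
proof -
  obtain S where S: "finite S"
    "\<And>t. t \<in> {0..1} - S \<Longrightarrow> (\<gamma> has_vector_derivative vector_derivative \<gamma> (at t within {0..1})) (at t)"
    using valid_path_has_vector_derivative[OF assms] by blast
  have "vector_derivative (cnj \<circ> \<gamma>) (at t within {0..1}) = cnj (vector_derivative \<gamma> (at t within {0..1}))"
    if t: "t \<in> {0..1} - S" for t
  proof (rule vector_derivative_at_within_ivl)
    show "((cnj \<circ> \<gamma>) has_vector_derivative cnj (vector_derivative \<gamma> (at t within {0..1}))) (at t)"
      unfolding o_def using S(2)[OF t] by (rule has_vector_derivative_cnj)
  qed (use t in auto)
  with S(1) show thesis by (rule that)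
qed

text \<open>The cycle formed by \<open>\<Gamma>\<close> and its complex conjugate is null-homologous in \<open>V\<close>, because
  conjugation preserves the domain but reverses orientation.\<close>

lemma conjugate_cycles_cancel:
  assumes H: "weakly_holomorphic H V"
  shows "cycle_integrable \<Gamma> (\<lambda>z dz. cmul dz (H z))"
    "cycle_integrable \<Gamma> (\<lambda>z dz. cmul (cnj dz) (H (cnj z)))"
    "cycle_integral \<Gamma> (\<lambda>z dz. cmul dz (H z)) + cycle_integral \<Gamma> (\<lambda>z dz. cmul (cnj dz) (H (cnj z))) = 0"
proof -
  have curve': "valid_path (cnj \<circ> \<gamma>)" "pathfinish (cnj \<circ> \<gamma>) = pathstart (cnj \<circ> \<gamma>)"
    "path_image (cnj \<circ> \<gamma>) \<subseteq> V" if "\<gamma> \<in> \<Gamma>" for \<gamma>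
  proof -
    show "valid_path (cnj \<circ> \<gamma>)" using \<Gamma>_curve(1)[OF that] by (simp add: valid_path_cnj)
    show "pathfinish (cnj \<circ> \<gamma>) = pathstart (cnj \<circ> \<gamma>)"
      using \<Gamma>_curve(2)[OF that] by (simp add: pathfinish_compose pathstart_compose)
    show "path_image (cnj \<circ> \<gamma>) \<subseteq> V"
      using \<Gamma>_curve(3)[OF that] cnj_V by (auto simp: path_image_compose)
  qed
  let ?w = "\<lambda>\<gamma> t. cmul (vector_derivative \<gamma> (at t within {0..1})) (H (\<gamma> t))"
  let ?v = "\<lambda>\<gamma> t. cmul (cnj (vector_derivative \<gamma> (at t within {0..1}))) (H (cnj (\<gamma> t)))"
  show 1: "cycle_integrable \<Gamma> (\<lambda>z dz. cmul dz (H z))"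
    unfolding cycle_integrable_def
    by (intro ballI weakly_holomorphic_integrable[OF H open_V] \<Gamma>_curve)
  \<comment> \<open>The derivative of the conjugate curve is the conjugate derivative only off a
    finite set, which does not affect the integral.\<close>
  have spike: "?v \<gamma> integrable_on {0..1} \<and> integral {0..1} (?v \<gamma>) = integral {0..1} (?w (cnj \<circ> \<gamma>))"
    if \<gamma>: "\<gamma> \<in> \<Gamma>" for \<gamma>
  proof -
    obtain S where S: "finite S" "\<And>t. t \<in> {0..1} - S \<Longrightarrow>
      vector_derivative (cnj \<circ> \<gamma>) (at t within {0..1}) = cnj (vector_derivative \<gamma> (at t within {0..1}))"
      using vector_derivative_cnj_path[OF \<Gamma>_curve(1)[OF \<gamma>]] by blast
    have "?w (cnj \<circ> \<gamma>) integrable_on {0..1}"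
      by (rule weakly_holomorphic_integrable[OF H open_V curve'(1,3)[OF \<gamma>]])
    then have "(?w (cnj \<circ> \<gamma>) has_integral integral {0..1} (?w (cnj \<circ> \<gamma>))) {0..1}"
      by (rule integrable_integral)
    then have "(?v \<gamma> has_integral integral {0..1} (?w (cnj \<circ> \<gamma>))) {0..1}"
      by (rule has_integral_spike_finite[OF S(1), rotated]) (simp add: S(2))
    then show ?thesis by (auto simp: has_integral_iff)
  qed
  then show 2: "cycle_integrable \<Gamma> (\<lambda>z dz. cmul (cnj dz) (H (cnj z)))"
    by (simp add: cycle_integrable_def)
  \<comment> \<open>The boolean tag makes the two families a disjoint union, so a curve and a
    conjugate curve never have to be shown distinct.\<close>
  define p where "p = (\<lambda>(\<gamma>, b). if b then cnj \<circ> \<gamma> else \<gamma> :: real \<Rightarrow> complex)"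
  have split: "(\<Sum>k\<in>\<Gamma> \<times> UNIV. g (p k)) = (\<Sum>\<gamma>\<in>\<Gamma>. g \<gamma>) + (\<Sum>\<gamma>\<in>\<Gamma>. g (cnj \<circ> \<gamma>))"
    for g :: "(real \<Rightarrow> complex) \<Rightarrow> 'd::comm_monoid_add"
  proof -
    have "(\<Sum>k\<in>\<Gamma> \<times> UNIV. g (p k)) = (\<Sum>\<gamma>\<in>\<Gamma>. \<Sum>b\<in>UNIV. g (p (\<gamma>, b)))"
      by (simp add: sum.cartesian_product)
    then show ?thesis by (simp add: p_def UNIV_bool sum.distrib)
  qed
  have "(\<Sum>k\<in>\<Gamma> \<times> UNIV. integral {0..1} (?w (p k))) = 0"
  proof (rule Cauchy_theorem_cycle_weakly_holomorphic[OF _ open_V H])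
    show "finite (\<Gamma> \<times> (UNIV :: bool set))" using finite_\<Gamma> by simp
    show "valid_path (p k) \<and> pathfinish (p k) = pathstart (p k) \<and> path_image (p k) \<subseteq> V"
      if "k \<in> \<Gamma> \<times> UNIV" for k
      using that \<Gamma>_curve[of "fst k"] curve'[of "fst k"] by (cases "snd k") (auto simp: p_def case_prod_beta)
    show "(\<Sum>k\<in>\<Gamma> \<times> UNIV. winding_number (p k) w) = 0" if "w \<notin> V" for w
      unfolding split[of "\<lambda>\<gamma>. winding_number \<gamma> w"] by (rule winding_number_cancel[OF that])
  qed
  then show "cycle_integral \<Gamma> (\<lambda>z dz. cmul dz (H z))
      + cycle_integral \<Gamma> (\<lambda>z dz. cmul (cnj dz) (H (cnj z))) = 0"
    unfolding split[of "\<lambda>\<gamma>. integral {0..1} (?w \<gamma>)"] using spike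
    by (simp add: cycle_integral_def)
qed

end

lemma bounded_linear_blinfun_compose:
  "bounded_linear (\<lambda>B. A o\<^sub>L B)" "bounded_linear (\<lambda>B. B o\<^sub>L A)"
  by (rule bounded_bilinear.bounded_linear_right[OF bounded_bilinear_blinfun_compose],
      rule bounded_bilinear.bounded_linear_left[OF bounded_bilinear_blinfun_compose])

section \<open>Comparison of the S-functional calculus with Riesz--Dunford integrals\<close>

context slice_calculus
begin

definition right_integrand :: "(quat \<Rightarrow> quat) \<Rightarrow> complex \<Rightarrow> complex \<Rightarrow> 'a \<Rightarrow>\<^sub>L 'a" where
  "right_integrand f z dz =
     lmul_op (f (slice_emb i z) * (- i * slice_emb i dz)) o\<^sub>L S_R_inv (slice_emb i z) T"

definition left_integrand :: "(quat \<Rightarrow> quat) \<Rightarrow> complex \<Rightarrow> complex \<Rightarrow> 'a \<Rightarrow>\<^sub>L 'a" where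
  "left_integrand f z dz =
     S_L_inv (slice_emb i z) T o\<^sub>L lmul_op ((- i * slice_emb i dz) * f (slice_emb i z))"

lemma calculus_eq:
  "S_calculus_right i \<Gamma> f T = (1 / (2 * pi)) *\<^sub>R cycle_integral \<Gamma> (right_integrand f)"
  "S_calculus_left i \<Gamma> f T = (1 / (2 * pi)) *\<^sub>R cycle_integral \<Gamma> (left_integrand f)"
  by (simp_all add: S_calculus_right_def S_calculus_left_def right_integrand_def[abs_def]
      left_integrand_def[abs_def])

text \<open>Formal real part of c (cnj z A - T A) with A = \<open>Qinv z\<close>. Only real
  multiples of A and T A occur, so the result does not depend on the side from which scalars act;
  likewise for \<open>imaginary_part\<close>.\<close>

definition real_part :: "complex \<Rightarrow> complex \<Rightarrow> 'a \<Rightarrow>\<^sub>L 'a" where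
  "real_part c z = Re (c * cnj z) *\<^sub>R Qinv z - Re c *\<^sub>R (T o\<^sub>L Qinv z)"

definition imaginary_part :: "complex \<Rightarrow> complex \<Rightarrow> 'a \<Rightarrow>\<^sub>L 'a" where
  "imaginary_part c z = Im (c * cnj z) *\<^sub>R Qinv z - Im c *\<^sub>R (T o\<^sub>L Qinv z)"

lemma cmul_i_cmul_i: "cmul \<i> (cmul \<i> A) = - A"
  by (simp flip: cs_mult) (simp add: minus_left cs_one)

lemma cmul_resolvent:
  "cmul c (resolvent z) = real_part c z + cmul \<i> (imaginary_part c z)"
proof -
  have "cmul c (resolvent z) = cmul (c * cnj z) (Qinv z) - cmul c (T o\<^sub>L Qinv z)"
    by (simp add: resolvent_def diff_right cs_mult)
  also have "\<dots> = real_part c z + cmul \<i> (imaginary_part c z)"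
    unfolding cs_eq[of "c * cnj z"] cs_eq[of c]
    by (simp add: real_part_def imaginary_part_def add_right diff_right scaleR_right algebra_simps)
  finally show ?thesis .
qed

text \<open>Passing to the conjugate point and the conjugate scalar keeps \<open>Qinv\<close> and
  conjugates the coefficients; the extra minus sign then flips the real part and keeps the imaginary
  one. The scalar \<open>- cnj c\<close> is what c = -i F(z) dz turns into on the conjugate
  curve.\<close>

lemma cmul_resolvent_cnj:
  "cmul (- cnj c) (resolvent (cnj z)) = - real_part c z + cmul \<i> (imaginary_part c z)"
proof -
  have "real_part (- cnj c) (cnj z) = - real_part c z"
    "imaginary_part (- cnj c) (cnj z) = imaginary_part c z"
    by (simp_all add: real_part_def imaginary_part_def Qinv_cnj algebra_simps)
  then show ?thesis by (simp only: cmul_resolvent)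
qed

lemma S_R_inv_eq:
  "lmul_op (slice_emb i c) o\<^sub>L S_R_inv (slice_emb i z) T
     = real_part c z + (lmul_op i o\<^sub>L imaginary_part c z)"
proof -
  have "S_R_inv (slice_emb i z) T = (lmul_op (slice_emb i (cnj z)) o\<^sub>L Qinv z) - (T o\<^sub>L Qinv z)"
    by (simp add: S_R_inv_def Qinv_def Q_op_slice_emb qcnj_slice_emb[OF i] blinfun_compose_linear)
  then have "lmul_op (slice_emb i c) o\<^sub>L S_R_inv (slice_emb i z) T
      = (lmul_op (slice_emb i (c * cnj z)) o\<^sub>L Qinv z) - (lmul_op (slice_emb i c) o\<^sub>L (T o\<^sub>L Qinv z))"
    by (simp add: blinfun_compose_linear slice_emb_mult[OF i] lmul_op_compose flip: blinfun_compose_assoc)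
  then show ?thesis
    unfolding lmul_op_slice_emb(1)
    by (simp add: real_part_def imaginary_part_def blinfun_compose_linear algebra_simps)
qed

text \<open>In the left S-resolvent the inverse of Q stands before \<open>T\<close>; membership in
  the resolvent part allows the two to be exchanged.\<close>

lemma S_L_inv_eq:
  assumes "z \<in> resolvent_part"
  shows "S_L_inv (slice_emb i z) T o\<^sub>L lmul_op (slice_emb i c)
    = real_part c z + (imaginary_part c z o\<^sub>L lmul_op i)"
proof -
  have "S_L_inv (slice_emb i z) T = (Qinv z o\<^sub>L lmul_op (slice_emb i (cnj z))) - (T o\<^sub>L Qinv z)"
    using Qinv(4)[OF assms]
    by (simp add: S_L_inv_def Q_op_slice_emb qcnj_slice_emb[OF i] blinfun_compose_linear flip: Qinv_def)
  then have "S_L_inv (slice_emb i z) T o\<^sub>L lmul_op (slice_emb i c)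
      = (Qinv z o\<^sub>L lmul_op (slice_emb i (c * cnj z))) - ((T o\<^sub>L Qinv z) o\<^sub>L lmul_op (slice_emb i c))"
    by (simp add: blinfun_compose_linear slice_emb_mult[OF i] mult.commute[of c] lmul_op_compose
        blinfun_compose_assoc)
  then show ?thesis
    unfolding lmul_op_slice_emb(2)
    by (simp add: real_part_def imaginary_part_def blinfun_compose_linear algebra_simps)
qed

lemma \<Gamma>_in_V: "\<gamma> \<in> \<Gamma> \<Longrightarrow> z \<in> path_image \<gamma> \<Longrightarrow> z \<in> V"
  using \<Gamma>_curve(3) by blast

lemma inverse_two_pi_i: "inverse (of_real (2 * pi) * i) = slice_emb i (- \<i> / of_real (2 * pi))"
proof (rule inverse_unique)
  have "of_real (2 * pi) * i = slice_emb i (of_real (2 * pi) * \<i>)"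
    by (simp only: slice_emb_mult[OF i] slice_emb_simps)
  then show "of_real (2 * pi) * i * slice_emb i (- \<i> / of_real (2 * pi)) = 1"
    by (simp flip: slice_emb_mult[OF i])
qed

text \<open>The factor 1/i is absorbed into the scalar -i F(z), which mirrors ds_i = -i ds in the
  S-functional calculus and so allows a comparison under the same constant.\<close>

lemma riesz_dunford_eq:
  assumes F: "F holomorphic_on slice_part U i"
    and f: "\<And>z. z \<in> slice_part U i \<Longrightarrow> f (slice_emb i z) = slice_emb i (F z)"
    and int: "cycle_integrable \<Gamma> (\<lambda>z dz. cmul dz (cmul (- \<i> * F z) (resolvent z)))"
  shows "riesz_dunford i \<Gamma> f T
    = (1 / (2 * pi)) *\<^sub>R cycle_integral \<Gamma> (\<lambda>z dz. cmul dz (cmul (- \<i> * F z) (resolvent z)))"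
    (is "_ = _ *\<^sub>R cycle_integral \<Gamma> ?w")
proof -
  have "cycle_integral \<Gamma> (\<lambda>z dz. rmul_op (f (slice_emb i z) * slice_emb i dz) o\<^sub>L
      op_inv (Delta (slice_emb i z) T)) = cycle_integral \<Gamma> (\<lambda>z dz. cmul \<i> (?w z dz))"
  proof (rule cycle_integral_cong)
    fix \<gamma> z dz assume "\<gamma> \<in> \<Gamma>" "z \<in> path_image \<gamma>"
    then have z: "z \<in> slice_part U i" "z \<in> resolvent_part" using \<Gamma>_in_V by (auto simp: V_def)
    have "rmul_op (f (slice_emb i z) * slice_emb i dz) o\<^sub>L op_inv (Delta (slice_emb i z) T)
        = cmul (F z * dz) (resolvent z)"
      by (simp add: f[OF z(1)] resolvent_inverse(3)[OF z(2)] cmul_def slice_emb_mult[OF i])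
    then show "rmul_op (f (slice_emb i z) * slice_emb i dz) o\<^sub>L op_inv (Delta (slice_emb i z) T)
        = cmul \<i> (?w z dz)"
      by (simp add: mult_ac flip: cs_mult)
  qed
  also have "\<dots> = cmul \<i> (cycle_integral \<Gamma> ?w)"
    by (rule cycle_integral_linear(2)[OF int bounded_linear_right])
  finally have "riesz_dunford i \<Gamma> f T
      = cmul (- \<i> / of_real (2 * pi)) (cmul \<i> (cycle_integral \<Gamma> ?w))"
    unfolding riesz_dunford_def inverse_two_pi_i by (simp add: cmul_def)
  also have "\<dots> = cmul (of_real (1 / (2 * pi))) (cycle_integral \<Gamma> ?w)"
    by (simp flip: cs_mult)
  finally show ?thesis by (simp only: cmul_of_real)
qed

lemma intrinsic_calculus:
  assumes f: "intrinsic_slice_hyperholomorphic U f"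
  shows "cycle_integrable \<Gamma> (right_integrand f)" "cycle_integrable \<Gamma> (left_integrand f)"
    "(1 / (2 * pi)) *\<^sub>R cycle_integral \<Gamma> (right_integrand f) = riesz_dunford i \<Gamma> f T"
    "(1 / (2 * pi)) *\<^sub>R cycle_integral \<Gamma> (left_integrand f) = riesz_dunford i \<Gamma> f T"
proof -
  obtain F where F: "F holomorphic_on slice_part U i"
    and F_cnj: "\<And>z. z \<in> slice_part U i \<Longrightarrow> F (cnj z) = cnj (F z)"
    and fF: "\<And>z. z \<in> slice_part U i \<Longrightarrow> f (slice_emb i z) = slice_emb i (F z)"
    using intrinsic_slice_restriction[OF f i] by blast
  define w where "w z dz = cmul dz (cmul (- \<i> * F z) (resolvent z))" for z dz
  define w' where "w' z dz = cmul (cnj dz) (cmul (- \<i> * F (cnj z)) (resolvent (cnj z)))" for z dz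
  let ?c = "\<lambda>z dz. - \<i> * F z * dz"
  let ?P = "\<lambda>z dz. real_part (?c z dz) z" and ?N = "\<lambda>z dz. imaginary_part (?c z dz) z"
  have "(\<lambda>z. - \<i> * F z) holomorphic_on V"
    by (intro holomorphic_intros holomorphic_on_subset[OF F]) (simp add: V_def)
  then have "weakly_holomorphic (\<lambda>z. cmul (- \<i> * F z) (resolvent z)) V"
    by (rule weakly_holomorphic_resolvent) (simp add: V_def)
  from conjugate_cycles_cancel[OF this]
  have w: "cycle_integrable \<Gamma> w" "cycle_integrable \<Gamma> w'"
    "cycle_integral \<Gamma> w + cycle_integral \<Gamma> w' = 0"
    unfolding w_def[abs_def] w'_def[abs_def] by simp_all
  have w_eq: "w z dz = ?P z dz + cmul \<i> (?N z dz)" for z dz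
  proof -
    have "w z dz = cmul (?c z dz) (resolvent z)"
      unfolding w_def by (simp add: mult_ac flip: cs_mult)
    then show ?thesis by (simp only: cmul_resolvent)
  qed
  have w'_eq: "w' z dz = - ?P z dz + cmul \<i> (?N z dz)" if "z \<in> V" for z dz
  proof -
    have "w' z dz = cmul (- cnj (?c z dz)) (resolvent (cnj z))"
      using F_cnj[of z] that unfolding w'_def by (simp add: V_def mult_ac flip: cs_mult)
    then show ?thesis by (simp only: cmul_resolvent_cnj)
  qed
  have N: "cycle_integrable \<Gamma> ?N" "cycle_integral \<Gamma> ?N = 0"
  proof -
    \<comment> \<open>In w + w' the real parts cancel and twice i times the imaginary part remains;
      \<open>?L\<close> undoes that factor, since i squares to -1.\<close>
    let ?L = "\<lambda>A. (- 1 / 2) *\<^sub>R cmul \<i> A"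
    have L: "bounded_linear ?L"
      by (rule bounded_linear_compose[OF bounded_linear_scaleR_right bounded_linear_right])
    have eq: "?L (w z dz + w' z dz) = ?N z dz" if "z \<in> V" for z dz
      unfolding w_eq w'_eq[OF that] by (simp add: add_right scaleR_right cmul_i_cmul_i scaleR_2[symmetric])
    note add = cycle_integral_add[OF w(1,2)] and lin = cycle_integral_linear[OF _ L]
    have "cycle_integrable \<Gamma> (\<lambda>z dz. ?L (w z dz + w' z dz))"
      "cycle_integral \<Gamma> (\<lambda>z dz. ?L (w z dz + w' z dz)) = 0"
      using lin[OF add(1)] by (simp_all add: add(2) w(3) zero_right)
    moreover note cycle_integral_cong[of \<Gamma> "\<lambda>z dz. ?L (w z dz + w' z dz)" ?N, OF eq[OF \<Gamma>_in_V]]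
    ultimately show "cycle_integrable \<Gamma> ?N" "cycle_integral \<Gamma> ?N = 0" by simp_all
  qed
  have P: "cycle_integrable \<Gamma> ?P" "cycle_integral \<Gamma> ?P = cycle_integral \<Gamma> w"
  proof -
    \<comment> \<open>The real part is w minus i times the imaginary part. It inherits
      integrability, and its integral is that of \<open>w\<close> because the other one
      vanishes.\<close>
    have L: "bounded_linear (\<lambda>A. - cmul \<i> A)"
      by (rule bounded_linear_minus[OF bounded_linear_right])
    note lin = cycle_integral_linear[OF N(1) L]
    note add = cycle_integral_add[OF w(1) lin(1)]
    have "(\<lambda>z dz. w z dz + - cmul \<i> (?N z dz)) = ?P"
      by (intro ext) (simp add: w_eq)
    then show "cycle_integrable \<Gamma> ?P" "cycle_integral \<Gamma> ?P = cycle_integral \<Gamma> w"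
      using add lin(2) N(2) by (simp_all add: zero_right)
  qed
  \<comment> \<open>For intrinsic \<open>f\<close> the value f(s), the unit \<open>i\<close> and ds
    lie in the same slice and commute, so the right and the left integrand carry the same
    scalar.\<close>
  have c: "slice_emb i (F z) * (- i * slice_emb i dz) = slice_emb i (?c z dz)"
    "- i * slice_emb i dz * slice_emb i (F z) = slice_emb i (?c z dz)" for z dz
  proof -
    have "- i = slice_emb i (- \<i>)" by (simp add: slice_emb_eq)
    then show "slice_emb i (F z) * (- i * slice_emb i dz) = slice_emb i (?c z dz)"
      "- i * slice_emb i dz * slice_emb i (F z) = slice_emb i (?c z dz)"
      by (simp_all only: slice_emb_mult[OF i, symmetric] mult_ac)
  qed
  have rd: "riesz_dunford i \<Gamma> f T = (1 / (2 * pi)) *\<^sub>R cycle_integral \<Gamma> w"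
    using riesz_dunford_eq[OF F fF] w(1) unfolding w_def[abs_def] by blast
  have "right_integrand f z dz = ?P z dz + (lmul_op i o\<^sub>L ?N z dz)" if "z \<in> V" for z dz
    using that by (simp only: right_integrand_def V_def Int_iff fF c S_R_inv_eq)
  note cong = cycle_integral_cong[of \<Gamma> "right_integrand f", OF this[OF \<Gamma>_in_V]]
  note lin = cycle_integral_linear[OF N(1) bounded_linear_blinfun_compose(1)[of "lmul_op i"]]
  show "cycle_integrable \<Gamma> (right_integrand f)"
    "(1 / (2 * pi)) *\<^sub>R cycle_integral \<Gamma> (right_integrand f) = riesz_dunford i \<Gamma> f T"
    using cong cycle_integral_add[OF P(1) lin(1)] lin(2) P(2) N(2) rd
    by (simp_all add: bounded_bilinear.zero_right[OF bounded_bilinear_blinfun_compose])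
  have "left_integrand f z dz = ?P z dz + (?N z dz o\<^sub>L lmul_op i)" if "z \<in> V" for z dz
    using that by (simp only: left_integrand_def V_def Int_iff fF c S_L_inv_eq)
  note cong = cycle_integral_cong[of \<Gamma> "left_integrand f", OF this[OF \<Gamma>_in_V]]
  note lin = cycle_integral_linear[OF N(1) bounded_linear_blinfun_compose(2)[of "lmul_op i"]]
  show "cycle_integrable \<Gamma> (left_integrand f)"
    "(1 / (2 * pi)) *\<^sub>R cycle_integral \<Gamma> (left_integrand f) = riesz_dunford i \<Gamma> f T"
    using cong cycle_integral_add[OF P(1) lin(1)] lin(2) P(2) N(2) rd
    by (simp_all add: bounded_bilinear.zero_left[OF bounded_bilinear_blinfun_compose])
qed

lemma \<Gamma>_in_U: "\<gamma> \<in> \<Gamma> \<Longrightarrow> z \<in> path_image \<gamma> \<Longrightarrow> slice_emb i z \<in> U"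
  using \<Gamma>_in_V by (auto simp: V_def slice_part_def)

text \<open>In the right integrand the value of \<open>f\<close> is the leftmost factor, so the
  basis units of the decomposition come out on the left of the integrals, leaving four intrinsic
  functions.\<close>

theorem S_calculus_right_eq:
  assumes "right_slice_hyperholomorphic U f"
  shows "\<exists>f1 f2 f3 f4.
    intrinsic_slice_hyperholomorphic U f1 \<and> intrinsic_slice_hyperholomorphic U f2 \<and>
    intrinsic_slice_hyperholomorphic U f3 \<and> intrinsic_slice_hyperholomorphic U f4 \<and>
    (\<forall>q\<in>U. f q = f1 q + qi * f2 q + qj * f3 q + qk * f4 q) \<and>
    S_calculus_right i \<Gamma> f T =
      riesz_dunford i \<Gamma> f1 T
      + (lmul_op qi o\<^sub>L riesz_dunford i \<Gamma> f2 T)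
      + (lmul_op qj o\<^sub>L riesz_dunford i \<Gamma> f3 T)
      + (lmul_op qk o\<^sub>L riesz_dunford i \<Gamma> f4 T)"
proof -
  obtain f1 f2 f3 f4 where f:
    "intrinsic_slice_hyperholomorphic U f1" "intrinsic_slice_hyperholomorphic U f2"
    "intrinsic_slice_hyperholomorphic U f3" "intrinsic_slice_hyperholomorphic U f4"
    and dec: "\<And>q. q \<in> U \<Longrightarrow> f q = f1 q + qi * f2 q + qj * f3 q + qk * f4 q"
    using right_slice_hyperholomorphic_decompose[OF assms] by blast
  interpret l: bounded_linear "lmul_op :: quat \<Rightarrow> 'a \<Rightarrow>\<^sub>L 'a" by (rule bounded_linear_lmul_op)
  have eq: "right_integrand f z dz = right_integrand f1 z dz + (lmul_op qi o\<^sub>L right_integrand f2 z dz)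
      + (lmul_op qj o\<^sub>L right_integrand f3 z dz) + (lmul_op qk o\<^sub>L right_integrand f4 z dz)"
    if "slice_emb i z \<in> U" for z dz
    unfolding right_integrand_def blinfun_compose_assoc[symmetric] lmul_op_compose dec[OF that]
    by (simp only: distrib_right mult.assoc l.add blinfun_compose_linear)
  note I = intrinsic_calculus(1)[OF f(1)] intrinsic_calculus(1)[OF f(2)]
    intrinsic_calculus(1)[OF f(3)] intrinsic_calculus(1)[OF f(4)]
  note l2 = cycle_integral_linear[OF I(2) bounded_linear_blinfun_compose(1)[of "lmul_op qi"]]
  note l3 = cycle_integral_linear[OF I(3) bounded_linear_blinfun_compose(1)[of "lmul_op qj"]]
  note l4 = cycle_integral_linear[OF I(4) bounded_linear_blinfun_compose(1)[of "lmul_op qk"]]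
  note a2 = cycle_integral_add[OF I(1) l2(1)]
  note a3 = cycle_integral_add[OF a2(1) l3(1)]
  note a4 = cycle_integral_add[OF a3(1) l4(1)]
  have "cycle_integral \<Gamma> (right_integrand f) = cycle_integral \<Gamma> (right_integrand f1)
      + (lmul_op qi o\<^sub>L cycle_integral \<Gamma> (right_integrand f2))
      + (lmul_op qj o\<^sub>L cycle_integral \<Gamma> (right_integrand f3))
      + (lmul_op qk o\<^sub>L cycle_integral \<Gamma> (right_integrand f4))"
    using cycle_integral_cong(2)[of \<Gamma> "right_integrand f", OF eq[OF \<Gamma>_in_U]]
    by (simp only: a2 a3 a4 l2 l3 l4)
  then have "S_calculus_right i \<Gamma> f T = riesz_dunford i \<Gamma> f1 T
      + (lmul_op qi o\<^sub>L riesz_dunford i \<Gamma> f2 T)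
      + (lmul_op qj o\<^sub>L riesz_dunford i \<Gamma> f3 T)
      + (lmul_op qk o\<^sub>L riesz_dunford i \<Gamma> f4 T)"
    unfolding calculus_eq f[THEN intrinsic_calculus(3), symmetric]
    by (simp add: blinfun_compose_linear scaleR_add_right)
  with f dec show ?thesis by blast
qed

text \<open>Here the value of \<open>f\<close> is the innermost factor, applied to vectors before
  the resolvent, so the basis units come out on the right.\<close>

theorem S_calculus_left_eq:
  assumes "left_slice_hyperholomorphic U f"
  shows "\<exists>f1 f2 f3 f4.
    intrinsic_slice_hyperholomorphic U f1 \<and> intrinsic_slice_hyperholomorphic U f2 \<and>
    intrinsic_slice_hyperholomorphic U f3 \<and> intrinsic_slice_hyperholomorphic U f4 \<and>
    (\<forall>q\<in>U. f q = f1 q + f2 q * qi + f3 q * qj + f4 q * qk) \<and>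
    S_calculus_left i \<Gamma> f T =
      riesz_dunford i \<Gamma> f1 T
      + (riesz_dunford i \<Gamma> f2 T o\<^sub>L lmul_op qi)
      + (riesz_dunford i \<Gamma> f3 T o\<^sub>L lmul_op qj)
      + (riesz_dunford i \<Gamma> f4 T o\<^sub>L lmul_op qk)"
proof -
  obtain f1 f2 f3 f4 where f:
    "intrinsic_slice_hyperholomorphic U f1" "intrinsic_slice_hyperholomorphic U f2"
    "intrinsic_slice_hyperholomorphic U f3" "intrinsic_slice_hyperholomorphic U f4"
    and dec: "\<And>q. q \<in> U \<Longrightarrow> f q = f1 q + f2 q * qi + f3 q * qj + f4 q * qk"
    using left_slice_hyperholomorphic_decompose[OF assms] by blast
  interpret l: bounded_linear "lmul_op :: quat \<Rightarrow> 'a \<Rightarrow>\<^sub>L 'a" by (rule bounded_linear_lmul_op)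
  have eq: "left_integrand f z dz = left_integrand f1 z dz + (left_integrand f2 z dz o\<^sub>L lmul_op qi)
      + (left_integrand f3 z dz o\<^sub>L lmul_op qj) + (left_integrand f4 z dz o\<^sub>L lmul_op qk)"
    if "slice_emb i z \<in> U" for z dz
    unfolding left_integrand_def blinfun_compose_assoc lmul_op_compose dec[OF that]
    by (simp only: distrib_left mult.assoc l.add blinfun_compose_linear)
  note I = intrinsic_calculus(2)[OF f(1)] intrinsic_calculus(2)[OF f(2)]
    intrinsic_calculus(2)[OF f(3)] intrinsic_calculus(2)[OF f(4)]
  note l2 = cycle_integral_linear[OF I(2) bounded_linear_blinfun_compose(2)[of "lmul_op qi"]]
  note l3 = cycle_integral_linear[OF I(3) bounded_linear_blinfun_compose(2)[of "lmul_op qj"]]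
  note l4 = cycle_integral_linear[OF I(4) bounded_linear_blinfun_compose(2)[of "lmul_op qk"]]
  note a2 = cycle_integral_add[OF I(1) l2(1)]
  note a3 = cycle_integral_add[OF a2(1) l3(1)]
  note a4 = cycle_integral_add[OF a3(1) l4(1)]
  have "cycle_integral \<Gamma> (left_integrand f) = cycle_integral \<Gamma> (left_integrand f1)
      + (cycle_integral \<Gamma> (left_integrand f2) o\<^sub>L lmul_op qi)
      + (cycle_integral \<Gamma> (left_integrand f3) o\<^sub>L lmul_op qj)
      + (cycle_integral \<Gamma> (left_integrand f4) o\<^sub>L lmul_op qk)"
    using cycle_integral_cong(2)[of \<Gamma> "left_integrand f", OF eq[OF \<Gamma>_in_U]]
    by (simp only: a2 a3 a4 l2 l3 l4)
  then have "S_calculus_left i \<Gamma> f T = riesz_dunford i \<Gamma> f1 T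
      + (riesz_dunford i \<Gamma> f2 T o\<^sub>L lmul_op qi)
      + (riesz_dunford i \<Gamma> f3 T o\<^sub>L lmul_op qj)
      + (riesz_dunford i \<Gamma> f4 T o\<^sub>L lmul_op qk)"
    unfolding calculus_eq f[THEN intrinsic_calculus(4), symmetric]
    by (simp add: blinfun_compose_linear scaleR_add_right)
  with f dec show ?thesis by blast
qed

end

theorem mainTheorem3:
  fixes T :: "'a::quat_banach \<Rightarrow>\<^sub>L 'a"
    and i :: quat
    and D :: "quat set"
    and \<Gamma> :: "(real \<Rightarrow> complex) set"
  assumes "right_linear T"
    and "i \<in> imag_sphere"
    and "slice_cauchy_domain D"
    and "bounded D"
    and "S_spectrum T \<subseteq> D"
    and "positively_oriented_boundary (slice_part D i) \<Gamma>"
  shows "(\<forall>U f. right_slice_hyperholomorphic U f \<and> closure D \<subseteq> U \<longrightarrow>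
           (\<exists>f1 f2 f3 f4.
              intrinsic_slice_hyperholomorphic U f1 \<and> intrinsic_slice_hyperholomorphic U f2 \<and>
              intrinsic_slice_hyperholomorphic U f3 \<and> intrinsic_slice_hyperholomorphic U f4 \<and>
              (\<forall>q\<in>U. f q = f1 q + qi * f2 q + qj * f3 q + qk * f4 q) \<and>
              S_calculus_right i \<Gamma> f T =
                riesz_dunford i \<Gamma> f1 T
                + (lmul_op qi o\<^sub>L riesz_dunford i \<Gamma> f2 T)
                + (lmul_op qj o\<^sub>L riesz_dunford i \<Gamma> f3 T)
                + (lmul_op qk o\<^sub>L riesz_dunford i \<Gamma> f4 T)))
       \<and> (\<forall>U f. left_slice_hyperholomorphic U f \<and> closure D \<subseteq> U \<longrightarrow>
           (\<exists>f1 f2 f3 f4.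
              intrinsic_slice_hyperholomorphic U f1 \<and> intrinsic_slice_hyperholomorphic U f2 \<and>
              intrinsic_slice_hyperholomorphic U f3 \<and> intrinsic_slice_hyperholomorphic U f4 \<and>
              (\<forall>q\<in>U. f q = f1 q + f2 q * qi + f3 q * qj + f4 q * qk) \<and>
              S_calculus_left i \<Gamma> f T =
                riesz_dunford i \<Gamma> f1 T
                + (riesz_dunford i \<Gamma> f2 T o\<^sub>L lmul_op qi)
                + (riesz_dunford i \<Gamma> f3 T o\<^sub>L lmul_op qj)
                + (riesz_dunford i \<Gamma> f4 T o\<^sub>L lmul_op qk)))"
proof -
  have calculus: "slice_calculus T i D U \<Gamma>"
    if "open U" "axially_symmetric U" "closure D \<subseteq> U" for U
    using assms that by unfold_locales (simp_all add: slice_cauchy_domain_def)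
  show ?thesis
  proof (intro conjI allI impI)
    fix U f assume f: "right_slice_hyperholomorphic U f \<and> closure D \<subseteq> U"
    then interpret slice_calculus T i D U \<Gamma>
      by (intro calculus) (simp_all add: right_slice_hyperholomorphic_def)
    from f show "\<exists>f1 f2 f3 f4.
        intrinsic_slice_hyperholomorphic U f1 \<and> intrinsic_slice_hyperholomorphic U f2 \<and>
        intrinsic_slice_hyperholomorphic U f3 \<and> intrinsic_slice_hyperholomorphic U f4 \<and>
        (\<forall>q\<in>U. f q = f1 q + qi * f2 q + qj * f3 q + qk * f4 q) \<and>
        S_calculus_right i \<Gamma> f T =
          riesz_dunford i \<Gamma> f1 T
          + (lmul_op qi o\<^sub>L riesz_dunford i \<Gamma> f2 T)
          + (lmul_op qj o\<^sub>L riesz_dunford i \<Gamma> f3 T)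
          + (lmul_op qk o\<^sub>L riesz_dunford i \<Gamma> f4 T)"
      by (intro S_calculus_right_eq) simp
  next
    fix U f assume f: "left_slice_hyperholomorphic U f \<and> closure D \<subseteq> U"
    then interpret slice_calculus T i D U \<Gamma>
      by (intro calculus) (simp_all add: left_slice_hyperholomorphic_def)
    from f show "\<exists>f1 f2 f3 f4.
        intrinsic_slice_hyperholomorphic U f1 \<and> intrinsic_slice_hyperholomorphic U f2 \<and>
        intrinsic_slice_hyperholomorphic U f3 \<and> intrinsic_slice_hyperholomorphic U f4 \<and>
        (\<forall>q\<in>U. f q = f1 q + f2 q * qi + f3 q * qj + f4 q * qk) \<and>
        S_calculus_left i \<Gamma> f T =
          riesz_dunford i \<Gamma> f1 T
          + (riesz_dunford i \<Gamma> f2 T o\<^sub>L lmul_op qi)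
          + (riesz_dunford i \<Gamma> f3 T o\<^sub>L lmul_op qj)
          + (riesz_dunford i \<Gamma> f4 T o\<^sub>L lmul_op qk)"
      by (intro S_calculus_left_eq) simp
  qed
qed

end
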